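(* Let $\epsilon>0$ and $0<\delta<1$. Let $r=(r_1,\dots,r_n)$ with $r_i\in[1,\infty]$, $m=(m_1,\dots,m_n)$ with $m_i\in\mathbb N$, $s\in[1,\infty]$, $m'\in\mathbb N$, and let $b_1,\dots,b_n\ge 0$. For $1\le i\le n$ let $\mathcal G_i:\ell_{r_i,e}^{m_i}\to\ell_{s,e}^{m'}$ be a causal (deterministic, not necessarily linear) system, and define $$\mathcal G(u_1,\dots,u_n)=\sum_{i=1}^n\mathcal G_i u_i .$$ Consider on $\ell_{r_1,e}^{m_1}\times\cdots\times\ell_{r_n,e}^{m_n}$ the adjacency relation: $\mathrm{Adj}^b(u,u')$ iff for some $i$, $\|u_i-u_i'\|_{r_i}\le b_i$, and $u_j=u_j'$ for all $j\ne i$. (1) The mechanism $Mu=\mathcal Gu+w$, where $w$ is a white noise (independent over time) with $w_t\sim\mathrm{Lap}(B/\epsilon)^{m'}$ and $B\ge\max_{1\le i\le n}\{\gamma^{inc}_{r_i,1}(\mathcal G_i)\,b_i\}$, is $\epsilon$-differentially private. (2) The mechanism $Mu=\mathcal Gu+w$, where $w$ is a white noise with $w_t\sim\mathcal N(0,\sigma^2 I_{m'})$ and $\sigma\ge\kappa(\delta,\epsilon)\max_{1\le i\le n}\{\gamma^{inc}_{r_i,2}(\mathcal G_i)\,b_i\}$, is $(\epsilon,\delta)$-differentially private.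
   Context: Signals are discrete-time and start at time $0$. For a signal $x$, $P_Tx$ is the truncation: $(P_Tx)_t=x_t$ for $t\le T$ and $0$ for $t>T$. A deterministic system $\mathcal G$ is causal iff $P_T\mathcal G=P_T\mathcal GP_T$ for all $T$. $\ell_{p,e}^m$ is the space of sequences $x$ with values in $\mathbb R^m$ such that $P_Tx$ has finite $p$-norm for all $T$; the $p$-norm of a signal is $\left(\sum_t\sum_j|x_{t,j}|^p\right)^{1/p}$ (with the usual modification for $p=\infty$). The incremental gain $\gamma^{inc}_{r,s}(\mathcal G)$ is the smallest number $\gamma$ such that $\|P_T\mathcal Gu-P_T\mathcal Gu'\|_s\le\gamma\|P_Tu-P_Tu'\|_r$ for all inputs $u,u'$ and all $T$ (in each part the gains appearing are assumed finite). $\mathrm{Lap}(c)$ is the Laplace distribution with density $\frac1{2c}e^{-|x|/c}$, and $\mathrm{Lap}(c)^k$ is the law of a vector with $k$ i.i.d. $\mathrm{Lap}(c)$ components. $\mathcal Q(x)=\frac1{\sqrt{2\pi}}\int_x^\infty e^{-u^2/2}du$, and $\kappa(\delta,\epsilon)=\frac1{2\epsilon}\left(K+\sqrt{K^2+2\epsilon}\right)$ with $K=\mathcal Q^{-1}(\delta)$. The output space $\ell_{s,e}^{m'}$ is equipped with the $\sigma$-algebra generated by the cylinder sets $\{y\in\ell_{s,e}^{m'}:(y_0,\dots,y_T)\in H\}$, $T\ge0$, $H$ Borel in $\mathbb R^{(T+1)m'}$. A mechanism $M$ assigns to each dataset (here, input signal) $u$ a random variable $Mu$ in the output space. It is $(\epsilon,\delta)$-differentially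 private if $\mathbb P(Mu\in S)\le e^\epsilon\,\mathbb P(Mu'\in S)+\delta$ for all adjacent $u,u'$ and all measurable $S$; $\epsilon$-differentially private means $\delta=0$. *)

theory Defs
  imports "HOL-Probability.Probability"
begin

text \<open>
  The dimensions \<open>m\<^sub>1, \<dots>, m\<^sub>n\<close> of the input channels vary with the index, so a vector of
  \<open>\<real>\<^sup>m\<close> is a function \<^typ>\<open>nat \<Rightarrow> real\<close> that vanishes at all arguments \<open>\<ge> m\<close>;
  \<open>x t j\<close> is the component \<open>j < m\<close> of the signal \<open>x\<close> at time \<open>t\<close>.
\<close>

type_synonym signal = "nat \<Rightarrow> nat \<Rightarrow> real"

definition signals :: "nat \<Rightarrow> signal set" where
  "signals m = {x. \<forall>t. \<forall>j\<ge>m. x t j = 0}"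

definition trunc :: "nat \<Rightarrow> signal \<Rightarrow> signal" where
  "trunc T x = (\<lambda>t j. if t \<le> T then x t j else 0)"

definition lp_norm :: "ennreal \<Rightarrow> nat \<Rightarrow> signal \<Rightarrow> ennreal" where
  "lp_norm p m x =
    (if p = \<infinity> then (SUP t. SUP j\<in>{..<m}. ennreal \<bar>x t j\<bar>)
     else let S = (\<Sum>t. \<Sum>j<m. ennreal (\<bar>x t j\<bar> powr enn2real p))
          in if S = \<infinity> then \<infinity> else ennreal (enn2real S powr (1 / enn2real p)))"

definition lpe :: "ennreal \<Rightarrow> nat \<Rightarrow> signal set" where
  "lpe p m = {x \<in> signals m. \<forall>T. lp_norm p m (trunc T x) < \<infinity>}"

definition causal_on :: "signal set \<Rightarrow> (signal \<Rightarrow> signal) \<Rightarrow> bool" where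
  "causal_on X G \<longleftrightarrow> (\<forall>T. \<forall>u\<in>X. trunc T (G u) = trunc T (G (trunc T u)))"

definition inc_gain_bound ::
    "ennreal \<Rightarrow> nat \<Rightarrow> ennreal \<Rightarrow> nat \<Rightarrow> (signal \<Rightarrow> signal) \<Rightarrow> ennreal \<Rightarrow> bool" where
  "inc_gain_bound r m s m' G \<gamma> \<longleftrightarrow>
    (\<forall>u\<in>lpe r m. \<forall>u'\<in>lpe r m. \<forall>T.
       lp_norm s m' (trunc T (G u) - trunc T (G u')) \<le> \<gamma> * lp_norm r m (trunc T u - trunc T u'))"

text \<open>
  An infinite gain means that no finite bound exists. A finite infimum is itself a bound, hence the
  smallest one: see \<open>inc_gain_is_least\<close> below.
\<close>

definition inc_gain :: "ennreal \<Rightarrow> nat \<Rightarrow> ennreal \<Rightarrow> nat \<Rightarrow> (signal \<Rightarrow> signal) \<Rightarrow> ennreal" where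
  "inc_gain r m s m' G = Inf {\<gamma>. inc_gain_bound r m s m' G \<gamma>}"

lemma lp_norm_trunc_finite:
  assumes "1 \<le> p"
  shows "lp_norm p m (trunc T x) < \<infinity>"
proof (cases "p = \<infinity>")
  case True
  define C where "C = (\<Sum>t\<le>T. \<Sum>j<m. ennreal \<bar>x t j\<bar>)"
  have "ennreal \<bar>trunc T x t j\<bar> \<le> C" if "j < m" for t j
  proof (cases "t \<le> T")
    case t: True
    have "ennreal \<bar>x t j\<bar> \<le> (\<Sum>j<m. ennreal \<bar>x t j\<bar>)"
      using that by (intro member_le_sum) auto
    also have "\<dots> \<le> C"
      unfolding C_def using t by (intro member_le_sum) auto
    finally show ?thesis using t by (simp add: trunc_def)
  qed (simp add: trunc_def)
  then have "lp_norm p m (trunc T x) \<le> C"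
    using True by (auto simp: lp_norm_def intro!: SUP_least)
  also have "C < \<infinity>" by (simp add: C_def)
  finally show ?thesis .
next
  case False
  have "(\<Sum>t. \<Sum>j<m. ennreal (\<bar>trunc T x t j\<bar> powr enn2real p)) =
      (\<Sum>t\<le>T. \<Sum>j<m. ennreal (\<bar>trunc T x t j\<bar> powr enn2real p))"
    by (rule suminf_finite) (auto simp: trunc_def)
  also have "\<dots> < \<infinity>" by simp
  finally show ?thesis using False by (auto simp: lp_norm_def Let_def)
qed

lemma trunc_diff: "trunc T x - trunc T y = trunc T (x - y)"
  by (auto simp: trunc_def fun_eq_iff)

lemma inc_gain_is_least:
  assumes "1 \<le> r" and fin: "inc_gain r m s m' G < \<infinity>"
  shows "inc_gain_bound r m s m' G (inc_gain r m s m' G)"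
    and "\<And>\<gamma>. inc_gain_bound r m s m' G \<gamma> \<Longrightarrow> inc_gain r m s m' G \<le> \<gamma>"
proof -
  let ?A = "{\<gamma>. inc_gain_bound r m s m' G \<gamma>}"
  have ne: "?A \<noteq> {}"
  proof
    assume "?A = {}"
    then show False using fin unfolding inc_gain_def by (simp del: Collect_empty_eq)
  qed
  show "inc_gain_bound r m s m' G (inc_gain r m s m' G)"
    unfolding inc_gain_bound_def
  proof (intro ballI allI)
    fix u u' T assume u: "u \<in> lpe r m" "u' \<in> lpe r m"
    let ?L = "lp_norm s m' (trunc T (G u) - trunc T (G u'))"
    let ?c = "lp_norm r m (trunc T u - trunc T u')"
    have c: "?c < \<infinity>"
      unfolding trunc_diff by (rule lp_norm_trunc_finite[OF assms(1)])
    have le: "?L \<le> \<gamma> * ?c" if "\<gamma> \<in> ?A" for \<gamma>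
      using that u by (auto simp: inc_gain_bound_def)
    show "?L \<le> inc_gain r m s m' G * ?c"
    proof (cases "?c = 0")
      case True
      then show ?thesis using ne le by fastforce
    next
      case False
      have "?L / ?c \<le> inc_gain r m s m' G"
        unfolding inc_gain_def
      proof (rule Inf_greatest)
        fix \<gamma> assume "\<gamma> \<in> ?A"
        from le[OF this] have "?L / ?c \<le> \<gamma> * ?c / ?c"
          by (rule divide_right_mono_ennreal)
        also have "\<dots> = \<gamma>" using False c by (simp add: mult_divide_eq_ennreal)
        finally show "?L / ?c \<le> \<gamma>" .
      qed
      then have "?L / ?c * ?c \<le> inc_gain r m s m' G * ?c"
        by (rule mult_right_mono) simp
      then show ?thesis
        using False c by (simp add: ennreal_divide_times ennreal_times_divide[symmetric] mult_divide_eq_ennreal)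
    qed
  qed
  show "\<And>\<gamma>. inc_gain_bound r m s m' G \<gamma> \<Longrightarrow> inc_gain r m s m' G \<le> \<gamma>"
    by (auto simp: inc_gain_def intro: Inf_lower)
qed

definition cyl_algebra :: "ennreal \<Rightarrow> nat \<Rightarrow> signal measure" where
  "cyl_algebra s m' = sigma (lpe s m')
     {{y \<in> lpe s m'. (\<lambda>(t, j)\<in>{..T} \<times> {..<m'}. y t j) \<in> H} | T H.
        H \<in> sets (Pi\<^sub>M ({..T} \<times> {..<m'}) (\<lambda>_. borel))}"

definition sum_system :: "nat \<Rightarrow> (nat \<Rightarrow> signal \<Rightarrow> signal) \<Rightarrow> (nat \<Rightarrow> signal) \<Rightarrow> signal" where
  "sum_system n G u = (\<lambda>t j. \<Sum>i=1..n. G i (u i) t j)"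

definition adj ::
    "nat \<Rightarrow> (nat \<Rightarrow> ennreal) \<Rightarrow> (nat \<Rightarrow> nat) \<Rightarrow> (nat \<Rightarrow> real)
      \<Rightarrow> (nat \<Rightarrow> signal) \<Rightarrow> (nat \<Rightarrow> signal) \<Rightarrow> bool" where
  "adj n r m b u u' \<longleftrightarrow>
    (\<exists>i\<in>{1..n}. lp_norm (r i) (m i) (u i - u' i) \<le> ennreal (b i) \<and>
       (\<forall>j\<in>{1..n}. j \<noteq> i \<longrightarrow> u j = u' j))"

text \<open>
  For scale \<open>0\<close>, which is admissible when all gains times \<open>b\<^sub>i\<close> vanish, both noise laws are the
  point mass at \<open>0\<close>; the density formulas would give the null measure there.
\<close>

definition laplace :: "real \<Rightarrow> real measure" where
  "laplace c = (if c = 0 then return borel 0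
     else density lborel (\<lambda>x. ennreal (1 / (2 * c) * exp (- \<bar>x\<bar> / c))))"

definition centered_normal :: "real \<Rightarrow> real measure" where
  "centered_normal \<sigma> = (if \<sigma> = 0 then return borel 0
     else density lborel (\<lambda>x. ennreal (normal_density 0 \<sigma> x)))"

text \<open>
  White noise in \<open>\<real>\<^sup>m\<close> whose samples have \<open>m\<close> i.i.d. components of law \<open>\<mu>\<close>. The restriction
  turns a zero-extended vector into a point of the product space over \<^term>\<open>{..<m}\<close>.
\<close>

definition white_noise ::
    "'a measure \<Rightarrow> nat \<Rightarrow> real measure \<Rightarrow> ('a \<Rightarrow> signal) \<Rightarrow> bool" where
  "white_noise \<Omega> m \<mu> w \<longleftrightarrow>
    (\<forall>\<omega>\<in>space \<Omega>. w \<omega> \<in> signals m) \<and>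
    prob_space.indep_vars \<Omega> (\<lambda>_. Pi\<^sub>M {..<m} (\<lambda>_. borel)) (\<lambda>t \<omega>. restrict (w \<omega> t) {..<m}) UNIV \<and>
    (\<forall>t. distr \<Omega> (Pi\<^sub>M {..<m} (\<lambda>_. borel)) (\<lambda>\<omega>. restrict (w \<omega> t) {..<m}) = Pi\<^sub>M {..<m} (\<lambda>_. \<mu>))"

definition Qfun :: "real \<Rightarrow> real" where
  "Qfun x = 1 / sqrt (2 * pi) * (LINT u:{x..}|lborel. exp (- u\<^sup>2 / 2))"

definition \<kappa> :: "real \<Rightarrow> real \<Rightarrow> real" where
  "\<kappa> \<delta> \<epsilon> = (let K = inv Qfun \<delta> in 1 / (2 * \<epsilon>) * (K + sqrt (K\<^sup>2 + 2 * \<epsilon>)))"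

definition diff_private ::
    "'a measure \<Rightarrow> 'y measure \<Rightarrow> 'd set \<Rightarrow> ('d \<Rightarrow> 'd \<Rightarrow> bool)
      \<Rightarrow> real \<Rightarrow> real \<Rightarrow> ('d \<Rightarrow> 'a \<Rightarrow> 'y) \<Rightarrow> bool" where
  "diff_private \<Omega> Y D Adj \<epsilon> \<delta> M \<longleftrightarrow>
    (\<forall>u\<in>D. M u \<in> \<Omega> \<rightarrow>\<^sub>M Y) \<and>
    (\<forall>u\<in>D. \<forall>u'\<in>D. Adj u u' \<longrightarrow>
       (\<forall>S\<in>sets Y. measure \<Omega> {\<omega> \<in> space \<Omega>. M u \<omega> \<in> S}
                 \<le> exp \<epsilon> * measure \<Omega> {\<omega> \<in> space \<Omega>. M u' \<omega> \<in> S} + \<delta>))"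

definition noisy ::
    "('d \<Rightarrow> signal) \<Rightarrow> ('a \<Rightarrow> signal) \<Rightarrow> 'd \<Rightarrow> 'a \<Rightarrow> signal" where
  "noisy F w u \<omega> = (\<lambda>t j. F u t j + w \<omega> t j)"

end

theory Submission
  imports Defs
begin

text \<open>
  Adjacent inputs change the output of the summed system, on every window \<open>{0..T}\<close>, by at most
  \<open>\<gamma>\<^sub>i b\<^sub>i\<close> in the relevant norm. On a window the two outputs have explicit product densities: for Laplace
  noise their ratio is at most \<open>e\<^sup>\<epsilon>\<close> everywhere; for Gaussian noise it is at most \<open>e\<^sup>\<epsilon>\<close> on a half space
  whose complement has probability \<open>Q(\<epsilon>\<sigma>/\<parallel>v\<parallel> - \<parallel>v\<parallel>/(2\<sigma>)) \<le> \<delta>\<close>, where \<open>v\<close> is the difference of the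
  noiseless outputs and \<open>\<kappa>\<close> is the positive root of \<open>\<epsilon>\<kappa> - 1/(2\<kappa>) = Q\<^sup>-\<^sup>1(\<delta>)\<close>. Every measurable set of
  signals is approximated, under both output laws at once, by cylinders, so the inequality passes from
  windows to the whole \<open>\<sigma>\<close>-algebra.
\<close>

subsection \<open>Extending an inequality from a generating algebra\<close>

text \<open>Induction over \<open>sigma_sets\<close>. Complementing both sets leaves the symmetric
  difference unchanged, and a countable union is first cut down to finitely many members. One set
  \<open>C\<close> has to serve both measures, because the inequality to be transported compares
  \<open>M\<close> and \<open>N\<close> on the same set.\<close>

lemma sigma_algebra_approx:
  assumes "algebra X A" and M: "finite_measure M" and N: "finite_measure N"
    and sM: "sets M = sigma_sets X A" and sN: "sets N = sigma_sets X A"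
    and S: "S \<in> sigma_sets X A" and "0 < e"
  shows "\<exists>C\<in>A. measure M (S - C \<union> (C - S)) < e \<and> measure N (S - C \<union> (C - S)) < e"
  using S \<open>0 < e\<close>
proof (induction arbitrary: e)
  interpret A: algebra X A by fact
  interpret M: finite_measure M by fact
  interpret N: finite_measure N by fact
  have inM: "C \<in> sets M" "C \<in> sets N" if "C \<in> A" for C
    using that by (auto simp: sM sN)
  {
    case (Basic a)
    then show ?case by (intro bexI[of _ a]) auto
  next
    case Empty
    then show ?case by (intro bexI[of _ "{}"]) auto
  next
    case (Compl a)
    then obtain C where C: "C \<in> A" "measure M (a - C \<union> (C - a)) < e" "measure N (a - C \<union> (C - a)) < e"
      by blast
    have "a \<subseteq> X" "C \<subseteq> X"
      using Compl.hyps C A.space_closed sigma_sets_into_sp[of A X] by auto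
    then have "(X - a) - (X - C) \<union> ((X - C) - (X - a)) = a - C \<union> (C - a)"
      by blast
    with C show ?case by (intro bexI[of _ "X - C"]) auto
  next
    case (Union S)
    let ?U = "\<Union>i. S i" and ?P = "\<lambda>n. \<Union>i<n. S i"
    have S: "S i \<in> sets M" "S i \<in> sets N" for i
      using Union.hyps by (auto simp: sM sN)
    \<comment> \<open>The remainders of the union decrease to the empty set, so their measure tends
      to 0 by continuity from above. The two eventual bounds are then combined to obtain a common
      \<open>n\<close>.\<close>
    have tail: "\<forall>\<^sub>F n in sequentially. measure K (?U - ?P n) < e / 2"
      if K: "finite_measure K" "\<And>i. S i \<in> sets K" for K
    proof -
      interpret K: finite_measure K by fact
      have "(\<lambda>n. measure K (?U - ?P n)) \<longlonglongrightarrow> measure K (\<Inter>n. ?U - ?P n)"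
        using K by (intro K.finite_Lim_measure_decseq) (auto simp: decseq_def)
      also have "(\<Inter>n. ?U - ?P n) = {}" by auto
      finally show ?thesis
        using \<open>0 < e\<close> by (intro order_tendstoD(2)[where y = 0]) auto
    qed
    have "\<forall>\<^sub>F n in sequentially. measure M (?U - ?P n) < e / 2 \<and> measure N (?U - ?P n) < e / 2"
      using tail[OF M] tail[OF N] S by (auto intro: eventually_conj)
    then obtain n where n: "measure M (?U - ?P n) < e / 2" "measure N (?U - ?P n) < e / 2"
      by (auto simp: eventually_sequentially)
    \<comment> \<open>The \<open>n\<close> approximation errors add up to at most
      \<open>e / 2\<close>, the other half being the remainder; the \<open>+ 1\<close> keeps
      \<open>d\<close> positive when \<open>n = 0\<close>.\<close>
    define d where "d = e / (2 * (real n + 1))"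
    have "0 < d" using \<open>0 < e\<close> by (simp add: d_def)
    from Union.IH[OF this] obtain C where C: "\<And>i. C i \<in> A"
      "\<And>i. measure M (S i - C i \<union> (C i - S i)) < d" "\<And>i. measure N (S i - C i \<union> (C i - S i)) < d"
      by metis
    let ?D = "\<Union>i<n. C i"
    have err: "measure K (?U - ?D \<union> (?D - ?U)) < e"
      if K: "finite_measure K" "\<And>i. S i \<in> sets K" "\<And>i. C i \<in> sets K"
        and Kn: "measure K (?U - ?P n) < e / 2"
        and Kd: "\<And>i. measure K (S i - C i \<union> (C i - S i)) < d" for K
    proof -
      interpret K: finite_measure K by fact
      have "measure K (?U - ?D \<union> (?D - ?U))
          \<le> measure K ((?U - ?P n) \<union> (\<Union>i<n. S i - C i \<union> (C i - S i)))"
        using K by (intro K.finite_measure_mono) auto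
      also have "\<dots> \<le> measure K (?U - ?P n) + measure K (\<Union>i<n. S i - C i \<union> (C i - S i))"
        using K by (intro measure_Un_le) auto
      also have "measure K (\<Union>i<n. S i - C i \<union> (C i - S i))
          \<le> (\<Sum>i<n. measure K (S i - C i \<union> (C i - S i)))"
        using K by (intro measure_UNION_le) auto
      also have "\<dots> \<le> (\<Sum>i<n. d)"
        using Kd by (intro sum_mono) (auto intro: less_imp_le)
      also have "\<dots> \<le> e / 2"
        using \<open>0 < e\<close> by (simp add: d_def field_simps)
      finally show ?thesis using Kn by linarith
    qed
    have "?D \<in> A" using C(1) by (intro A.finite_UN) auto
    then show ?case
      using err[OF M S(1) inM(1)[OF C(1)] n(1) C(2)] err[OF N S(2) inM(2)[OF C(1)] n(2) C(3)] by blast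
  }
qed

text \<open>The family of sets that satisfy such an inequality need not be closed under complements,
  so a Dynkin argument on the generator does not apply. Instead \<open>S\<close> is replaced by a
  nearby member of the algebra, at an arbitrarily small cost on both sides.\<close>

lemma measure_le_extend:
  assumes alg: "algebra X A" and M: "finite_measure M" and N: "finite_measure N"
    and sM: "sets M = sigma_sets X A" and sN: "sets N = sigma_sets X A"
    and le: "\<And>C. C \<in> A \<Longrightarrow> measure M C \<le> c * measure N C + \<delta>" and "0 \<le> (c :: real)"
    and S: "S \<in> sigma_sets X A"
  shows "measure M S \<le> c * measure N S + \<delta>"
proof (rule field_le_epsilon)
  interpret M: finite_measure M by fact
  interpret N: finite_measure N by fact
  fix e :: real assume "0 < e"
  \<comment> \<open>Replacing \<open>S\<close> costs \<open>d\<close> under \<open>M\<close> and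
    \<open>c * d\<close> under \<open>c * N\<close>, in total \<open>e\<close>.\<close>
  define d where "d = e / (c + 1)"
  have "0 < d" using \<open>0 < e\<close> \<open>0 \<le> c\<close> by (simp add: d_def)
  then obtain C where C: "C \<in> A" "measure M (S - C \<union> (C - S)) < d" "measure N (S - C \<union> (C - S)) < d"
    using sigma_algebra_approx[OF alg M N sM sN S] by blast
  have mem: "C \<in> sets M" "C \<in> sets N" "S \<in> sets M" "S \<in> sets N"
    using C S by (auto simp: sM sN)
  have "measure M S \<le> measure M (C \<union> (S - C \<union> (C - S)))"
    using mem by (intro M.finite_measure_mono) auto
  also have "\<dots> \<le> measure M C + measure M (S - C \<union> (C - S))"
    using mem by (intro measure_Un_le) auto
  finally have 1: "measure M S \<le> measure M C + d" using C by linarith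
  have "measure N C \<le> measure N (S \<union> (S - C \<union> (C - S)))"
    using mem by (intro N.finite_measure_mono) auto
  also have "\<dots> \<le> measure N S + measure N (S - C \<union> (C - S))"
    using mem by (intro measure_Un_le) auto
  finally have "c * measure N C \<le> c * (measure N S + d)"
    using C \<open>0 \<le> c\<close> by (intro mult_left_mono) auto
  then have "measure M S \<le> c * measure N S + \<delta> + (c + 1) * d"
    using 1 le[OF C(1)] by (simp add: algebra_simps)
  also have "(c + 1) * d = e" using \<open>0 \<le> c\<close> by (simp add: d_def)
  finally show "measure M S \<le> c * measure N S + \<delta> + e" .
qed

subsection \<open>White noise on a finite window\<close>

text \<open>Finite density values keep every factor \<sigma>-finite, so the product measure is
  determined by its values on boxes, where the integral factorises coordinate by coordinate. This
  supplies the explicit window densities for both kinds of noise.\<close>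

lemma PiM_density:
  fixes f :: "'i \<Rightarrow> 'b \<Rightarrow> ennreal"
  assumes "product_sigma_finite M" and "finite I"
    and f[measurable]: "\<And>i. f i \<in> borel_measurable (M i)" and fin: "\<And>i x. f i x \<noteq> \<infinity>"
  shows "Pi\<^sub>M I (\<lambda>i. density (M i) (f i)) = density (Pi\<^sub>M I M) (\<lambda>x. \<Prod>i\<in>I. f i (x i))"
proof -
  interpret product_sigma_finite M by fact
  interpret D: product_sigma_finite "\<lambda>i. density (M i) (f i)"
    unfolding product_sigma_finite_def
    using fin f
    by (auto simp: sigma_finite_measure.sigma_finite_iff_density_finite[OF sigma_finite_measures])
  note [simp] = \<open>finite I\<close>
  show ?thesis
  proof (rule D.PiM_eqI[symmetric])
    show "sets (density (Pi\<^sub>M I M) (\<lambda>x. \<Prod>i\<in>I. f i (x i))) = sets (Pi\<^sub>M I (\<lambda>i. density (M i) (f i)))"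
      by (simp cong: sets_PiM_cong)
    fix A assume "\<And>i. i \<in> I \<Longrightarrow> A i \<in> sets (density (M i) (f i))"
    then have A[measurable]: "\<And>i. i \<in> I \<Longrightarrow> A i \<in> sets (M i)" by simp
    have "emeasure (density (Pi\<^sub>M I M) (\<lambda>x. \<Prod>i\<in>I. f i (x i))) (Pi\<^sub>E I A)
        = (\<integral>\<^sup>+x. (\<Prod>i\<in>I. f i (x i)) * indicator (Pi\<^sub>E I A) x \<partial>Pi\<^sub>M I M)"
      by (subst emeasure_density) (auto intro!: sets_PiM_I_finite)
    also have "\<dots> = (\<integral>\<^sup>+x. (\<Prod>i\<in>I. f i (x i) * indicator (A i) (x i)) \<partial>Pi\<^sub>M I M)"
    proof (intro nn_integral_cong)
      fix x assume "x \<in> space (Pi\<^sub>M I M)"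
      \<comment> \<open>Points of the product space are extensional, so membership in the box is
        just a condition on each coordinate in \<open>I\<close>.\<close>
      then have "indicator (Pi\<^sub>E I A) x = (\<Prod>i\<in>I. indicator (A i) (x i) :: ennreal)"
        by (auto simp: indicator_def space_PiM PiE_iff prod_zero_iff)
      then show "(\<Prod>i\<in>I. f i (x i)) * indicator (Pi\<^sub>E I A) x
          = (\<Prod>i\<in>I. f i (x i) * indicator (A i) (x i))"
        by (simp add: prod.distrib)
    qed
    also have "\<dots> = (\<Prod>i\<in>I. \<integral>\<^sup>+x. f i x * indicator (A i) x \<partial>M i)"
      by (intro product_nn_integral_prod) auto
    also have "\<dots> = (\<Prod>i\<in>I. emeasure (density (M i) (f i)) (A i))"
      by (intro prod.cong) (auto simp: emeasure_density)
    finally show "emeasure (density (Pi\<^sub>M I M) (\<lambda>x. \<Prod>i\<in>I. f i (x i))) (Pi\<^sub>E I A)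
      = (\<Prod>i\<in>I. emeasure (density (M i) (f i)) (A i))" .
  qed simp
qed

text \<open>Translation invariance of Lebesgue measure; here \<open>h\<close> will be a noiseless
  output value and \<open>f\<close> the noise density.\<close>

lemma distr_density_lborel_shift:
  fixes f :: "real \<Rightarrow> ennreal"
  assumes [measurable]: "f \<in> borel_measurable borel"
  shows "distr (density lborel f) borel (\<lambda>x. h + x) = density lborel (\<lambda>x. f (x - h))"
proof (rule measure_eqI)
  fix A assume "A \<in> sets (distr (density lborel f) borel (\<lambda>x. h + x))"
  then have [measurable]: "A \<in> sets borel" by simp
  have "emeasure (density lborel (\<lambda>x. f (x - h))) A = (\<integral>\<^sup>+x. f (x - h) * indicator A x \<partial>lborel)"
    by (simp add: emeasure_density)
  also have "\<dots> = (\<integral>\<^sup>+x. f (x - h) * indicator A x \<partial>distr lborel borel (\<lambda>x. h + x))"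
    by (simp add: lborel_distr_plus)
  also have "\<dots> = (\<integral>\<^sup>+x. f x * indicator A (h + x) \<partial>lborel)"
    by (subst nn_integral_distr) auto
  also have "\<dots> = emeasure (distr (density lborel f) borel (\<lambda>x. h + x)) A"
  proof -
    have "(\<lambda>x. h + x) -` A \<in> sets borel"
      using measurable_sets[of "\<lambda>x. h + x" borel borel A] by simp
    then show ?thesis
      by (subst emeasure_distr)
        (auto simp: emeasure_density intro!: nn_integral_cong split: split_indicator)
  qed
  finally show "emeasure (distr (density lborel f) borel (\<lambda>x. h + x)) A = emeasure (density lborel (\<lambda>x. f (x - h))) A"
    by simp
qed simp

lemma white_noise_borel_measurable:
  assumes "prob_space \<Omega>" and wn: "white_noise \<Omega> m \<mu> w"
  shows "(\<lambda>\<omega>. w \<omega> t j) \<in> borel_measurable \<Omega>"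
proof (cases "j < m")
  case True
  interpret prob_space \<Omega> by fact
  have "(\<lambda>\<omega>. restrict (w \<omega> t) {..<m}) \<in> \<Omega> \<rightarrow>\<^sub>M Pi\<^sub>M {..<m} (\<lambda>_. borel)"
    using wn by (auto simp: white_noise_def indep_vars_def)
  then have "(\<lambda>\<omega>. restrict (w \<omega> t) {..<m} j) \<in> borel_measurable \<Omega>"
    by (rule measurable_compose[OF _ measurable_component_singleton]) (simp add: True)
  then show ?thesis using True by simp
next
  case False
  then have "w \<omega> t j = 0" if "\<omega> \<in> space \<Omega>" for \<omega>
    using wn that by (auto simp: white_noise_def signals_def)
  then show ?thesis by (subst measurable_cong[where g = "\<lambda>_. 0"]) auto
qed

text \<open>Independence over time separates the time steps, and the product law of each sample
  separates its components. Together they give a product over all pairs (time, component), which is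
  checked on boxes.\<close>

lemma white_noise_shifted_law:
  fixes f :: "real \<Rightarrow> ennreal" and h :: "nat \<times> nat \<Rightarrow> real" and T :: nat
  assumes "prob_space \<Omega>" and wn: "white_noise \<Omega> m (density lborel f) w"
    and f[measurable]: "f \<in> borel_measurable borel" and fin: "\<And>x. f x \<noteq> \<infinity>"
  defines "I \<equiv> {..T} \<times> {..<m}"
  shows "distr \<Omega> (Pi\<^sub>M I (\<lambda>_. borel)) (\<lambda>\<omega>. \<lambda>i\<in>I. h i + w \<omega> (fst i) (snd i))
    = Pi\<^sub>M I (\<lambda>i. density lborel (\<lambda>x. f (x - h i)))"
proof -
  interpret prob_space \<Omega> by fact
  have sf: "sigma_finite_measure (density lborel (\<lambda>x. f (x - a)))" for a
    using fin by (auto simp: sigma_finite_measure.sigma_finite_iff_density_finite[OF lborel.sigma_finite_measure_axioms])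
  interpret D: product_sigma_finite "\<lambda>i. density lborel (\<lambda>x. f (x - h i))"
    using sf by (auto simp: product_sigma_finite_def)
  interpret D0: product_sigma_finite "\<lambda>_::nat. density lborel f"
    using sf[of 0] by (auto simp: product_sigma_finite_def)
  note [measurable] = white_noise_borel_measurable[OF assms(1) wn]
  let ?X = "\<lambda>t \<omega>. restrict (w \<omega> t) {..<m}"
  have indep: "indep_vars (\<lambda>_. Pi\<^sub>M {..<m} (\<lambda>_. borel)) ?X UNIV"
    and law: "\<And>t. distr \<Omega> (Pi\<^sub>M {..<m} (\<lambda>_. borel)) (?X t) = Pi\<^sub>M {..<m} (\<lambda>_. density lborel f)"
    using wn by (auto simp: white_noise_def)
  have X: "?X t \<in> \<Omega> \<rightarrow>\<^sub>M Pi\<^sub>M {..<m} (\<lambda>_. borel)" for t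
    by (intro measurable_restrict) measurable
  have "finite I" by (simp add: I_def)
  then show ?thesis
  proof (rule D.PiM_eqI)
    show "sets (distr \<Omega> (Pi\<^sub>M I (\<lambda>_. borel)) (\<lambda>\<omega>. \<lambda>i\<in>I. h i + w \<omega> (fst i) (snd i)))
        = sets (Pi\<^sub>M I (\<lambda>i. density lborel (\<lambda>x. f (x - h i))))"
      by (simp cong: sets_PiM_cong)
    fix A assume "\<And>i. i \<in> I \<Longrightarrow> A i \<in> sets (density lborel (\<lambda>x. f (x - h i)))"
    then have A: "A i \<in> sets borel" if "i \<in> I" for i using that by simp
    \<comment> \<open>Moving the shift from the noise to the sides of the box turns the event into
      one about \<open>w\<close> alone.\<close>
    define B where "B t j = (\<lambda>x. h (t, j) + x) -` A (t, j)" for t j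
    have B: "B t j \<in> sets borel" if "t \<le> T" "j < m" for t j
      unfolding B_def using that A[of "(t, j)"] measurable_sets[of "\<lambda>x. h (t, j) + x" borel borel "A (t, j)"]
      by (simp add: I_def)
    have Bt: "Pi\<^sub>E {..<m} (B t) \<in> sets (Pi\<^sub>M {..<m} (\<lambda>_. borel))" if "t \<le> T" for t
      using B that by (intro sets_PiM_I_finite) auto
    have meas: "(\<lambda>\<omega>. \<lambda>i\<in>I. h i + w \<omega> (fst i) (snd i)) \<in> \<Omega> \<rightarrow>\<^sub>M Pi\<^sub>M I (\<lambda>_. borel)"
      by (intro measurable_restrict) measurable
    have "emeasure (distr \<Omega> (Pi\<^sub>M I (\<lambda>_. borel)) (\<lambda>\<omega>. \<lambda>i\<in>I. h i + w \<omega> (fst i) (snd i))) (Pi\<^sub>E I A)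
        = emeasure \<Omega> ((\<lambda>\<omega>. \<lambda>i\<in>I. h i + w \<omega> (fst i) (snd i)) -` Pi\<^sub>E I A \<inter> space \<Omega>)"
      using A \<open>finite I\<close> by (intro emeasure_distr meas sets_PiM_I_finite) auto
    \<comment> \<open>The event splits into one condition per time step. The set
      \<open>{..T}\<close> is finite and nonempty, as the product rule for independent variables
      requires.\<close>
    also have "(\<lambda>\<omega>. \<lambda>i\<in>I. h i + w \<omega> (fst i) (snd i)) -` Pi\<^sub>E I A \<inter> space \<Omega>
        = (\<Inter>t\<in>{..T}. ?X t -` Pi\<^sub>E {..<m} (B t) \<inter> space \<Omega>)"
      by (auto simp: I_def B_def PiE_iff)
    also have "emeasure \<Omega> \<dots> = (\<Prod>t\<in>{..T}. emeasure \<Omega> (?X t -` Pi\<^sub>E {..<m} (B t) \<inter> space \<Omega>))"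
      using indep_varsD[OF indep, of "{..T}" "\<lambda>t. Pi\<^sub>E {..<m} (B t)"] Bt
      by (simp add: emeasure_eq_measure prod_ennreal del: INT_simps)
    also have "\<dots> = (\<Prod>t\<in>{..T}. emeasure (Pi\<^sub>M {..<m} (\<lambda>_. density lborel f)) (Pi\<^sub>E {..<m} (B t)))"
    proof (intro prod.cong refl)
      fix t assume "t \<in> {..T}"
      then show "emeasure \<Omega> (?X t -` Pi\<^sub>E {..<m} (B t) \<inter> space \<Omega>)
          = emeasure (Pi\<^sub>M {..<m} (\<lambda>_. density lborel f)) (Pi\<^sub>E {..<m} (B t))"
        using Bt by (simp add: law[of t, symmetric] emeasure_distr[OF X])
    qed
    also have "\<dots> = (\<Prod>t\<in>{..T}. \<Prod>j<m. emeasure (density lborel f) (B t j))"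
      using B by (intro prod.cong refl D0.emeasure_PiM) auto
    also have "\<dots> = (\<Prod>t\<in>{..T}. \<Prod>j<m. emeasure (density lborel (\<lambda>x. f (x - h (t, j)))) (A (t, j)))"
    proof (intro prod.cong refl)
      fix t j assume "t \<in> {..T}" "j \<in> {..<m}"
      then show "emeasure (density lborel f) (B t j) = emeasure (density lborel (\<lambda>x. f (x - h (t, j)))) (A (t, j))"
        using A[of "(t, j)"]
        by (subst distr_density_lborel_shift[OF f, symmetric]) (simp add: emeasure_distr B_def I_def)
    qed
    also have "\<dots> = (\<Prod>i\<in>I. emeasure (density lborel (\<lambda>x. f (x - h i))) (A i))"
      by (simp add: I_def prod.cartesian_product split_beta)
    finally show "emeasure (distr \<Omega> (Pi\<^sub>M I (\<lambda>_. borel)) (\<lambda>\<omega>. \<lambda>i\<in>I. h i + w \<omega> (fst i) (snd i))) (Pi\<^sub>E I A)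
        = (\<Prod>i\<in>I. emeasure (density lborel (\<lambda>x. f (x - h i))) (A i))" .
  qed
qed

section \<open>Likelihood ratio of shifted Laplace noise\<close>

text \<open>By the triangle inequality each factor changes by at most
  \<open>exp (\<bar>h i - h' i\<bar> / c)\<close>. In the product the exponents add up to the 1-norm
  distance divided by \<open>c\<close>, which is why the gain into the 1-norm governs Laplace noise.
  The pointwise bound is then integrated over \<open>H\<close>.\<close>

lemma laplace_product_le:
  fixes h h' :: "'i \<Rightarrow> real"
  assumes "finite I" and "0 < c" and le: "(\<Sum>i\<in>I. \<bar>h i - h' i\<bar>) \<le> \<epsilon> * c"
    and H: "H \<in> sets (Pi\<^sub>M I (\<lambda>_. borel))"
  defines "f \<equiv> \<lambda>x. ennreal (1 / (2 * c) * exp (- \<bar>x\<bar> / c))"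
  shows "emeasure (Pi\<^sub>M I (\<lambda>i. density lborel (\<lambda>x. f (x - h i)))) H
    \<le> ennreal (exp \<epsilon>) * emeasure (Pi\<^sub>M I (\<lambda>i. density lborel (\<lambda>x. f (x - h' i)))) H"
proof -
  have [measurable]: "f \<in> borel_measurable borel" unfolding f_def by measurable
  have ps: "product_sigma_finite (\<lambda>_::'i. lborel :: real measure)"
    by (simp add: product_sigma_finite_def lborel.sigma_finite_measure_axioms)
  have fin: "f x \<noteq> \<infinity>" for x by (simp add: f_def)
  have Hl[measurable]: "H \<in> sets (Pi\<^sub>M I (\<lambda>_. lborel))" using H by (simp cong: sets_PiM_cong)
  have em: "emeasure (Pi\<^sub>M I (\<lambda>i. density lborel (\<lambda>x. f (x - g i)))) H
     = (\<integral>\<^sup>+x. (\<Prod>i\<in>I. f (x i - g i)) * indicator H x \<partial>Pi\<^sub>M I (\<lambda>_. lborel))" for g :: "'i \<Rightarrow> real"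
    using \<open>finite I\<close> fin by (subst PiM_density[OF ps]) (auto simp: emeasure_density)
  have "(\<Prod>i\<in>I. f (x i - h i)) \<le> ennreal (exp \<epsilon>) * (\<Prod>i\<in>I. f (x i - h' i))" for x
  proof -
    have "f (x i - h i) \<le> ennreal (exp (\<bar>h i - h' i\<bar> / c)) * f (x i - h' i)" for i
    proof -
      have "- \<bar>x i - h i\<bar> / c \<le> \<bar>h i - h' i\<bar> / c + - \<bar>x i - h' i\<bar> / c"
        using \<open>0 < c\<close> by (simp add: field_simps)
      then have "exp (- \<bar>x i - h i\<bar> / c) \<le> exp (\<bar>h i - h' i\<bar> / c) * exp (- \<bar>x i - h' i\<bar> / c)"
        by (simp add: exp_add[symmetric])
      then show ?thesis
        using \<open>0 < c\<close> unfolding f_def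
        by (subst ennreal_mult[symmetric]) (auto intro!: ennreal_leI simp: field_simps)
    qed
    then have "(\<Prod>i\<in>I. f (x i - h i)) \<le> (\<Prod>i\<in>I. ennreal (exp (\<bar>h i - h' i\<bar> / c)) * f (x i - h' i))"
      by (intro prod_mono_ennreal)
    also have "\<dots> = ennreal (exp ((\<Sum>i\<in>I. \<bar>h i - h' i\<bar>) / c)) * (\<Prod>i\<in>I. f (x i - h' i))"
      using \<open>finite I\<close> by (simp add: prod.distrib prod_ennreal exp_sum[symmetric] sum_divide_distrib)
    also have "\<dots> \<le> ennreal (exp \<epsilon>) * (\<Prod>i\<in>I. f (x i - h' i))"
      using le \<open>0 < c\<close> by (intro mult_right_mono ennreal_leI) (auto simp: field_simps)
    finally show ?thesis .
  qed
  then have "emeasure (Pi\<^sub>M I (\<lambda>i. density lborel (\<lambda>x. f (x - h i)))) H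
     \<le> (\<integral>\<^sup>+x. ennreal (exp \<epsilon>) * ((\<Prod>i\<in>I. f (x i - h' i)) * indicator H x) \<partial>Pi\<^sub>M I (\<lambda>_. lborel))"
    unfolding em by (intro nn_integral_mono) (auto simp: mult.assoc[symmetric] split: split_indicator)
  also have "\<dots> = ennreal (exp \<epsilon>) * (\<integral>\<^sup>+x. (\<Prod>i\<in>I. f (x i - h' i)) * indicator H x \<partial>Pi\<^sub>M I (\<lambda>_. lborel))"
    by (intro nn_integral_cmult) measurable
  finally show ?thesis unfolding em .
qed

subsection \<open>Gaussian noise\<close>

text \<open>Reading the integral as a probability makes monotonicity of measures and the theory of
  distribution functions available for \<open>Qfun\<close>.\<close>

lemma Qfun_eq_measure: "Qfun x = measure std_normal_distribution {x..}"
proof -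
  have "emeasure std_normal_distribution {x..}
      = (\<integral>\<^sup>+u. ennreal (indicator {x..} u * std_normal_density u) \<partial>lborel)"
    by (subst emeasure_density) (auto intro!: nn_integral_cong split: split_indicator)
  also have "\<dots> = ennreal (LINT u|lborel. indicator {x..} u * std_normal_density u)"
    by (intro nn_integral_eq_integral integrable_real_mult_indicator[of _ _ std_normal_density, simplified mult.commute])
      (auto split: split_indicator)
  also have "(LINT u|lborel. indicator {x..} u * std_normal_density u) = Qfun x"
    unfolding Qfun_def set_lebesgue_integral_def std_normal_density_def
    by (subst integral_mult_right_zero[symmetric]) (auto intro!: Bochner_Integration.integral_cong)
  finally have "emeasure std_normal_distribution {x..} = ennreal (Qfun x)" .
  moreover have "0 \<le> Qfun x"
    unfolding Qfun_def set_lebesgue_integral_def by (auto intro!: mult_nonneg_nonneg integral_nonneg)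
  ultimately show ?thesis by (simp add: measure_def)
qed

lemma Qfun_antimono: "x \<le> y \<Longrightarrow> Qfun y \<le> Qfun x"
proof -
  interpret real_distribution std_normal_distribution by (rule real_dist_normal_dist)
  assume "x \<le> y"
  then show ?thesis unfolding Qfun_eq_measure by (intro finite_measure_mono) auto
qed

text \<open>It suffices that \<open>\<delta>\<close> lies in the range of \<open>Qfun\<close>. This
  follows from the intermediate value theorem, since \<open>Qfun\<close> is 1 minus a continuous
  distribution function with limits 0 and 1.\<close>

lemma Qfun_inv:
  assumes "0 < \<delta>" "\<delta> < 1"
  shows "Qfun (inv Qfun \<delta>) = \<delta>"
proof (rule f_inv_into_f)
  interpret D: real_distribution std_normal_distribution by (rule real_dist_normal_dist)
  \<comment> \<open>The absence of atoms serves twice: it reconciles \<open>{x..}\<close> in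
    \<open>Qfun\<close> with \<open>{..x}\<close> in \<open>cdf\<close>, and it makes
    \<open>cdf\<close> continuous.\<close>
  have atom: "measure std_normal_distribution {x} = 0" for x
  proof -
    have "emeasure std_normal_distribution {x} = 0"
      using AE_lborel_singleton[of x]
      by (subst emeasure_density) (auto simp: nn_integral_0_iff_AE split: split_indicator)
    then show ?thesis by (simp add: measure_def)
  qed
  have Q: "Qfun x = 1 - cdf std_normal_distribution x" for x
  proof -
    have "measure std_normal_distribution ({..<x} \<union> {x..}) = measure std_normal_distribution {..<x} + Qfun x"
      unfolding Qfun_eq_measure by (intro D.finite_measure_Union) auto
    moreover have "{..<x} \<union> {x..} = UNIV" by auto
    moreover have "measure std_normal_distribution ({..<x} \<union> {x})
        = measure std_normal_distribution {..<x} + measure std_normal_distribution {x}"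
      by (intro D.finite_measure_Union) auto
    moreover have "{..<x} \<union> {x} = {..x}" by auto
    ultimately show ?thesis using atom[of x] D.prob_space by (simp add: cdf_def)
  qed
  have cont: "isCont (cdf std_normal_distribution) x" for x
    using atom by (simp add: D.isCont_cdf)
  have "\<forall>\<^sub>F x in at_top. 1 - \<delta> < cdf std_normal_distribution x"
    using D.cdf_lim_at_top_prob assms by (intro order_tendstoD) auto
  then obtain b where b: "\<And>x. x \<ge> b \<Longrightarrow> 1 - \<delta> < cdf std_normal_distribution x"
    by (auto simp: eventually_at_top_linorder)
  have "\<forall>\<^sub>F x in at_bot. cdf std_normal_distribution x < 1 - \<delta>"
    using D.cdf_lim_at_bot assms by (intro order_tendstoD) auto
  then obtain a where a: "\<And>x. x \<le> a \<Longrightarrow> cdf std_normal_distribution x < 1 - \<delta>"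
    by (auto simp: eventually_at_bot_linorder)
  \<comment> \<open>The bound at \<open>a\<close> persists to the left and the one at
    \<open>b\<close> to the right, so \<open>min\<close> and \<open>max\<close> give correctly
    ordered endpoints.\<close>
  have "\<exists>x. min a b \<le> x \<and> x \<le> max a b \<and> cdf std_normal_distribution x = 1 - \<delta>"
    using a[of "min a b"] b[of "max a b"] cont by (intro IVT) auto
  then obtain x where "cdf std_normal_distribution x = 1 - \<delta>" by blast
  then show "\<delta> \<in> range Qfun" using Q[of x] by (intro range_eqI[of _ _ x]) simp
qed

lemma (in prob_space) normal_upper_tail:
  assumes "0 < s" and X: "distributed M lborel X (normal_density \<mu> s)"
  shows "prob {x \<in> space M. a \<le> X x} = Qfun ((a - \<mu>) / s)"
proof -
  have D: "distributed M lborel (\<lambda>x. (X x - \<mu>) / s) std_normal_density"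
    using normal_standard_normal_convert[OF \<open>0 < s\<close>] X by blast
  then have "(\<lambda>x. (X x - \<mu>) / s) \<in> M \<rightarrow>\<^sub>M lborel" "std_normal_distribution = distr M lborel (\<lambda>x. (X x - \<mu>) / s)"
    by (auto simp: distributed_def)
  then have "Qfun ((a - \<mu>) / s) = prob ((\<lambda>x. (X x - \<mu>) / s) -` {(a - \<mu>) / s..} \<inter> space M)"
    by (simp add: Qfun_eq_measure measure_distr)
  also have "(\<lambda>x. (X x - \<mu>) / s) -` {(a - \<mu>) / s..} \<inter> space M = {x \<in> space M. a \<le> X x}"
    using \<open>0 < s\<close> by (auto simp: divide_le_cancel)
  finally show ?thesis by simp
qed

text \<open>For \<open>v = h - h'\<close> the log-likelihood ratio of two Gaussian window laws is an
  affine function of this weighted sum, so its law determines how likely a large ratio is.\<close>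

lemma distributed_weighted_sum_normal_PiM:
  fixes h v :: "'i \<Rightarrow> real"
  assumes "finite I" and "0 < \<sigma>" and ne: "\<exists>i\<in>I. v i \<noteq> 0"
  defines "N \<equiv> Pi\<^sub>M I (\<lambda>i. density lborel (normal_density (h i) \<sigma>))"
  shows "distributed N lborel (\<lambda>x. \<Sum>i\<in>I. v i * x i)
    (normal_density (\<Sum>i\<in>I. v i * h i) (\<sigma> * sqrt (\<Sum>i\<in>I. (v i)\<^sup>2)))"
proof -
  \<comment> \<open>The library result on sums of independent normals needs nonzero variances.\<close>
  let ?J = "{i \<in> I. v i \<noteq> 0}"
  have pr: "prob_space (density lborel (normal_density (h i) \<sigma>))" for i
    using \<open>0 < \<sigma>\<close> by (rule prob_space_normal_density)
  interpret prob_space N unfolding N_def by (intro prob_space_PiM pr)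
  have comp[measurable]: "(\<lambda>x. x i) \<in> borel_measurable N" if "i \<in> I" for i
    using measurable_component_singleton[OF that, of "\<lambda>i. density lborel (normal_density (h i) \<sigma>)"]
    by (simp add: N_def)
  have d: "distr N borel (\<lambda>x. x i) = density lborel (normal_density (h i) \<sigma>)" if "i \<in> I" for i
  proof -
    have "distr N (density lborel (normal_density (h i) \<sigma>)) (\<lambda>x. x i) = density lborel (normal_density (h i) \<sigma>)"
      unfolding N_def by (rule distr_PiM_component[OF pr that])
    moreover have "distr N (density lborel (normal_density (h i) \<sigma>)) (\<lambda>x. x i) = distr N borel (\<lambda>x. x i)"
      by (intro distr_cong) auto
    ultimately show ?thesis by simp
  qed
  \<comment> \<open>The joint law of the coordinates is \<open>N\<close> itself, which is the
    product of their marginals.\<close>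
  have "indep_vars (\<lambda>_. borel) (\<lambda>i x. x i) I"
  proof (subst indep_vars_iff_distr_eq_PiM')
    show "I \<noteq> {}" using ne by auto
    have "distr N (Pi\<^sub>M I (\<lambda>_. borel)) (\<lambda>x. \<lambda>i\<in>I. x i) = distr N N (\<lambda>x. x)"
      by (intro distr_cong refl) (auto simp: N_def space_PiM PiE_iff extensional_restrict cong: sets_PiM_cong)
    also have "\<dots> = N" by (simp add: distr_id2)
    also have "\<dots> = Pi\<^sub>M I (\<lambda>i. distr N borel (\<lambda>x. x i))"
      unfolding N_def[abs_def] using d by (intro PiM_cong) (simp_all add: N_def)
    finally show "distr N (Pi\<^sub>M I (\<lambda>_. borel)) (\<lambda>x. \<lambda>i\<in>I. x i) = Pi\<^sub>M I (\<lambda>i. distr N borel (\<lambda>x. x i))" .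
  qed (use comp in auto)
  then have "indep_vars (\<lambda>_. borel) (\<lambda>i x. v i * x i) I"
    by (rule indep_vars_compose2) measurable
  then have indep: "indep_vars (\<lambda>_. borel) (\<lambda>i x. v i * x i) ?J"
    by (rule indep_vars_subset) auto
  have "distributed N lborel (\<lambda>x. \<Sum>i\<in>?J. v i * x i)
      (normal_density (\<Sum>i\<in>?J. v i * h i) (sqrt (\<Sum>i\<in>?J. (\<bar>v i\<bar> * \<sigma>)\<^sup>2)))"
  proof (rule sum_indep_normal[OF _ _ indep])
    show "distributed N lborel (\<lambda>x. v i * x i) (normal_density (v i * h i) (\<bar>v i\<bar> * \<sigma>))" if "i \<in> ?J" for i
    proof -
      have "distributed N lborel (\<lambda>x. x i) (normal_density (h i) \<sigma>)"
        using that d[of i] comp[of i] by (auto simp: distributed_def cong: distr_cong)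
      from normal_density_affine[OF this, of "v i" 0] show ?thesis
        using that \<open>0 < \<sigma>\<close> by simp
    qed
  qed (use \<open>finite I\<close> \<open>0 < \<sigma>\<close> ne in auto)
  moreover have "(\<Sum>i\<in>?J. v i * y i) = (\<Sum>i\<in>I. v i * y i)" for y :: "'i \<Rightarrow> real"
    using \<open>finite I\<close> by (intro sum.mono_neutral_left) auto
  moreover have "(\<Sum>i\<in>?J. (\<bar>v i\<bar> * \<sigma>)\<^sup>2) = (\<Sum>i\<in>I. (\<bar>v i\<bar> * \<sigma>)\<^sup>2)"
    using \<open>finite I\<close> by (intro sum.mono_neutral_left) auto
  moreover have "sqrt (\<Sum>i\<in>I. (\<bar>v i\<bar> * \<sigma>)\<^sup>2) = \<sigma> * sqrt (\<Sum>i\<in>I. (v i)\<^sup>2)"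
    using \<open>0 < \<sigma>\<close> by (simp add: power_mult_distrib sum_distrib_right[symmetric] real_sqrt_mult)
  ultimately show ?thesis by simp
qed

section \<open>The constant \<open>\<kappa>\<close> and the Gaussian likelihood ratio\<close>

lemma kappa_pos: "0 < \<epsilon> \<Longrightarrow> 0 < \<kappa> \<delta> \<epsilon>"
proof -
  assume "0 < \<epsilon>"
  then have "\<bar>inv Qfun \<delta>\<bar> < sqrt ((inv Qfun \<delta>)\<^sup>2 + 2 * \<epsilon>)"
    by (intro real_less_rsqrt) simp
  then show ?thesis using \<open>0 < \<epsilon>\<close> by (simp add: \<kappa>_def Let_def)
qed

text \<open>With \<open>K = inv Qfun \<delta>\<close>, clearing denominators gives the quadratic
  \<open>2 * \<epsilon> * k^2 - 2 * K * k - 1 = 0\<close>, whose positive root is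
  \<open>\<kappa> \<delta> \<epsilon>\<close>.\<close>

lemma kappa_equation:
  assumes "0 < \<epsilon>"
  shows "\<epsilon> * \<kappa> \<delta> \<epsilon> - 1 / (2 * \<kappa> \<delta> \<epsilon>) = inv Qfun \<delta>"
proof -
  define K where "K = inv Qfun \<delta>"
  define q where "q = sqrt (K\<^sup>2 + 2 * \<epsilon>)"
  have q: "q\<^sup>2 = K\<^sup>2 + 2 * \<epsilon>" using assms by (simp add: q_def)
  have k: "\<kappa> \<delta> \<epsilon> = (K + q) / (2 * \<epsilon>)" by (simp add: \<kappa>_def Let_def K_def q_def)
  have pos: "0 < K + q" using kappa_pos[OF assms, of \<delta>] assms by (simp add: k zero_less_divide_iff)
  have "\<epsilon> * \<kappa> \<delta> \<epsilon> - 1 / (2 * \<kappa> \<delta> \<epsilon>) = (K + q) / 2 - \<epsilon> / (K + q)"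
    using assms pos by (simp add: k del: distrib_left_numeral)
  also have "\<dots> = ((K + q)\<^sup>2 - 2 * \<epsilon>) / (2 * (K + q))"
    using pos by (simp add: diff_divide_distrib power2_eq_square del: distrib_left_numeral)
  also have "(K + q)\<^sup>2 - 2 * \<epsilon> = K * (2 * (K + q))"
    using q by (simp add: power2_eq_square algebra_simps)
  also have "\<dots> / (2 * (K + q)) = K"
    using pos by simp
  finally show ?thesis by (simp add: K_def)
qed

text \<open>\<open>H\<close> is split along a half space \<open>Good\<close>: inside it the density
  ratio gives the factor \<open>exp \<epsilon>\<close>, and the mass outside it is absorbed by
  \<open>\<delta>\<close>.\<close>

lemma gaussian_product_le:
  fixes h h' :: "'i \<Rightarrow> real"
  assumes "finite I" and "0 < \<sigma>" and "0 < \<epsilon>" and "0 < \<delta>" "\<delta> < 1"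
    and le: "\<kappa> \<delta> \<epsilon> * sqrt (\<Sum>i\<in>I. (h i - h' i)\<^sup>2) \<le> \<sigma>"
    and H: "H \<in> sets (Pi\<^sub>M I (\<lambda>_. borel))"
  defines "N \<equiv> \<lambda>g. Pi\<^sub>M I (\<lambda>i. density lborel (normal_density (g i) \<sigma>))"
  shows "measure (N h) H \<le> exp \<epsilon> * measure (N h') H + \<delta>"
proof (cases "\<exists>i\<in>I. h i - h' i \<noteq> 0")
  \<comment> \<open>Equal means give equal laws. The case is separate because the main argument
    divides by \<open>V\<close>, the 2-norm of \<open>h - h'\<close>.\<close>
  case False
  then have "N h = N h'" unfolding N_def by (intro PiM_cong) auto
  moreover have "1 * measure (N h') H \<le> exp \<epsilon> * measure (N h') H"
    using \<open>0 < \<epsilon>\<close> by (intro mult_right_mono) auto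
  ultimately show ?thesis using \<open>0 < \<delta>\<close> by simp
next
  case True
  define v where "v i = h i - h' i" for i
  define V where "V = sqrt (\<Sum>i\<in>I. (v i)\<^sup>2)"
  \<comment> \<open>The log-likelihood ratio at \<open>x\<close> is
    \<open>(2 * y + V\<^sup>2) / (2 * \<sigma>\<^sup>2)\<close>, where \<open>y\<close> is the
    deviation of the sum of \<open>v i * x i\<close> from its mean under \<open>N h\<close>. It is
    at most \<open>\<epsilon>\<close> exactly when \<open>y \<le> a\<close>.\<close>
  define a where "a = \<epsilon> * \<sigma>\<^sup>2 - V\<^sup>2 / 2"
  have V2: "V\<^sup>2 = (\<Sum>i\<in>I. (v i)\<^sup>2)" by (simp add: V_def sum_nonneg)
  have "0 < V"
    using True \<open>finite I\<close> by (auto simp: V_def v_def intro!: sum_pos2)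
  have ps: "product_sigma_finite (\<lambda>_::'i. lborel :: real measure)"
    by (simp add: product_sigma_finite_def lborel.sigma_finite_measure_axioms)
  have Npr: "prob_space (N g)" for g
    unfolding N_def using \<open>0 < \<sigma>\<close> by (intro prob_space_PiM prob_space_normal_density)
  interpret N: prob_space "N h" by (rule Npr)
  interpret N': prob_space "N h'" by (rule Npr)
  have sN: "sets (N g) = sets (Pi\<^sub>M I (\<lambda>_. lborel))" for g
    unfolding N_def by (intro sets_PiM_cong) auto
  have spN: "space (N g) = space (Pi\<^sub>M I (\<lambda>_. lborel))" for g
    using sN by (rule sets_eq_imp_space_eq)
  let ?L = "Pi\<^sub>M I (\<lambda>_::'i. lborel :: real measure)"
  have Hl[measurable]: "H \<in> sets ?L" using H by (simp cong: sets_PiM_cong)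
  \<comment> \<open>The half space on which the likelihood ratio of \<open>N h\<close> to \<open>N h'\<close> is at most \<open>exp \<epsilon>\<close>.\<close>
  define Good where "Good = {x \<in> space ?L. \<not> a + (\<Sum>i\<in>I. v i * h i) \<le> (\<Sum>i\<in>I. v i * x i)}"
  have [measurable]: "Good \<in> sets ?L" unfolding Good_def by measurable
  have em: "emeasure (N g) A = (\<integral>\<^sup>+x. (\<Prod>i\<in>I. ennreal (normal_density (g i) \<sigma> (x i))) * indicator A x \<partial>?L)"
    if [measurable]: "A \<in> sets ?L" for g A
    unfolding N_def using \<open>finite I\<close> by (subst PiM_density[OF ps]) (auto simp: emeasure_density)
  have dens: "(\<Prod>i\<in>I. ennreal (normal_density (h i) \<sigma> (x i)))
      \<le> ennreal (exp \<epsilon>) * (\<Prod>i\<in>I. ennreal (normal_density (h' i) \<sigma> (x i)))" if "x \<in> Good" for x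
  proof -
    \<comment> \<open>Since \<open>x i - h' i = (x i - h i) + v i\<close>, the two squares differ by
      a term linear in \<open>x i\<close> plus \<open>(v i)\<^sup>2\<close>.\<close>
    have "normal_density (h i) \<sigma> (x i)
        = exp ((2 * (v i * x i - v i * h i) + (v i)\<^sup>2) / (2 * \<sigma>\<^sup>2)) * normal_density (h' i) \<sigma> (x i)" for i
    proof -
      have "(2 * (v i * x i - v i * h i) + (v i)\<^sup>2) / (2 * \<sigma>\<^sup>2) + - (x i - h' i)\<^sup>2 / (2 * \<sigma>\<^sup>2)
          = - (x i - h i)\<^sup>2 / (2 * \<sigma>\<^sup>2)"
        unfolding add_divide_distrib[symmetric]
        by (rule arg_cong[where f = "\<lambda>z. z / (2 * \<sigma>\<^sup>2)"]) (simp add: v_def power2_eq_square algebra_simps)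
      then show ?thesis
        unfolding normal_density_def by (simp add: exp_add[symmetric])
    qed
    then have "(\<Prod>i\<in>I. normal_density (h i) \<sigma> (x i))
        = exp (\<Sum>i\<in>I. (2 * (v i * x i - v i * h i) + (v i)\<^sup>2) / (2 * \<sigma>\<^sup>2)) * (\<Prod>i\<in>I. normal_density (h' i) \<sigma> (x i))"
      using \<open>finite I\<close> by (simp add: prod.distrib exp_sum)
    also have "(\<Sum>i\<in>I. (2 * (v i * x i - v i * h i) + (v i)\<^sup>2) / (2 * \<sigma>\<^sup>2))
        = (2 * ((\<Sum>i\<in>I. v i * x i) - (\<Sum>i\<in>I. v i * h i)) + V\<^sup>2) / (2 * \<sigma>\<^sup>2)"
      by (simp add: sum_divide_distrib[symmetric] sum.distrib sum_subtractf sum_distrib_left[symmetric] V2)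
    also have "exp \<dots> * (\<Prod>i\<in>I. normal_density (h' i) \<sigma> (x i))
        \<le> exp \<epsilon> * (\<Prod>i\<in>I. normal_density (h' i) \<sigma> (x i))"
    proof (intro mult_right_mono prod_nonneg)
      have "2 * ((\<Sum>i\<in>I. v i * x i) - (\<Sum>i\<in>I. v i * h i)) + V\<^sup>2 \<le> \<epsilon> * (2 * \<sigma>\<^sup>2)"
        using that by (simp add: Good_def a_def)
      then show "exp ((2 * ((\<Sum>i\<in>I. v i * x i) - (\<Sum>i\<in>I. v i * h i)) + V\<^sup>2) / (2 * \<sigma>\<^sup>2)) \<le> exp \<epsilon>"
        using \<open>0 < \<sigma>\<close> by (simp add: divide_le_eq)
    qed auto
    finally show ?thesis
      by (simp add: prod_ennreal prod_nonneg ennreal_mult[symmetric] ennreal_leI)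
  qed
  have "emeasure (N h) (H \<inter> Good) \<le> (\<integral>\<^sup>+x. ennreal (exp \<epsilon>)
      * ((\<Prod>i\<in>I. ennreal (normal_density (h' i) \<sigma> (x i))) * indicator (H \<inter> Good) x) \<partial>?L)"
    using dens by (subst em) (auto intro!: nn_integral_mono simp: mult.assoc[symmetric] split: split_indicator)
  also have "\<dots> = ennreal (exp \<epsilon>) * emeasure (N h') (H \<inter> Good)"
    by (subst em) (auto intro!: nn_integral_cmult)
  also have "\<dots> \<le> ennreal (exp \<epsilon>) * emeasure (N h') H"
    by (intro mult_left_mono emeasure_mono) (auto simp: sN)
  finally have good: "measure (N h) (H \<inter> Good) \<le> exp \<epsilon> * measure (N h') H"
    by (simp add: N.emeasure_eq_measure N'.emeasure_eq_measure ennreal_mult[symmetric])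
  have sV: "0 < \<sigma> * V" using \<open>0 < \<sigma>\<close> \<open>0 < V\<close> by simp
  \<comment> \<open>The weighted sum has standard deviation \<open>\<sigma> * V\<close>, so leaving
    \<open>Good\<close> is an upper tail event at the normalised level
    \<open>a / (\<sigma> * V)\<close>.\<close>
  have "distributed (N h) lborel (\<lambda>x. \<Sum>i\<in>I. v i * x i) (normal_density (\<Sum>i\<in>I. v i * h i) (\<sigma> * V))"
    using distributed_weighted_sum_normal_PiM[OF \<open>finite I\<close> \<open>0 < \<sigma>\<close>, of v h] True
    by (auto simp: N_def V_def v_def)
  from N.normal_upper_tail[OF sV this, of "a + (\<Sum>i\<in>I. v i * h i)"]
  have "measure (N h) (space (N h) - Good) = Qfun (a / (\<sigma> * V))"
    by (simp add: Good_def spN set_diff_eq cong: conj_cong)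
  also have "\<dots> \<le> Qfun (inv Qfun \<delta>)"
  proof (rule Qfun_antimono)
    let ?k = "\<kappa> \<delta> \<epsilon>"
    have k: "0 < ?k" "?k \<le> \<sigma> / V"
      using kappa_pos[OF \<open>0 < \<epsilon>\<close>] le \<open>0 < V\<close> by (auto simp: V_def v_def field_simps)
    have "inv Qfun \<delta> = \<epsilon> * ?k - 1 / (2 * ?k)" using kappa_equation[OF \<open>0 < \<epsilon>\<close>] by simp
    \<comment> \<open>The map from \<open>k\<close> to \<open>\<epsilon> * k - 1 / (2 * k)\<close>
      increases on positive \<open>k\<close>; it takes the value \<open>inv Qfun \<delta>\<close> at
      \<open>\<kappa> \<delta> \<epsilon>\<close> and \<open>a / (\<sigma> * V)\<close> at
      \<open>\<sigma> / V\<close>.\<close>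
    also have "\<dots> \<le> \<epsilon> * (\<sigma> / V) - 1 / (2 * (\<sigma> / V))"
      using k \<open>0 < \<epsilon>\<close> \<open>0 < \<sigma>\<close> \<open>0 < V\<close>
      by (intro diff_mono mult_left_mono divide_left_mono mult_pos_pos divide_pos_pos) auto
    also have "\<dots> = a / (\<sigma> * V)"
      using \<open>0 < V\<close> \<open>0 < \<sigma>\<close> by (simp add: a_def field_simps power2_eq_square)
    finally show "inv Qfun \<delta> \<le> a / (\<sigma> * V)" .
  qed
  also have "\<dots> = \<delta>" using \<open>0 < \<delta>\<close> \<open>\<delta> < 1\<close> by (rule Qfun_inv)
  finally have bad: "measure (N h) (space (N h) - Good) \<le> \<delta>" .
  have "measure (N h) H \<le> measure (N h) ((H \<inter> Good) \<union> (space (N h) - Good))"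
    using sets.sets_into_space[OF Hl] by (intro N.finite_measure_mono) (auto simp: sN spN)
  also have "\<dots> \<le> measure (N h) (H \<inter> Good) + measure (N h) (space (N h) - Good)"
    by (intro measure_Un_le) (auto simp: sN spN)
  finally show ?thesis using good bad by linarith
qed

subsection \<open>Truncated norms and cylinder sets\<close>

text \<open>A truncation has finitely many nonzero entries, so its norm is finite. The extended
  spaces therefore agree as sets for all exponents, and noisy outputs belong to them
  automatically.\<close>

lemma lpe_eq_signals: "1 \<le> p \<Longrightarrow> lpe p m = signals m"
  using lp_norm_trunc_finite by (auto simp: lpe_def)

lemma lp_norm_trunc_eq:
  assumes "p \<noteq> \<infinity>"
  shows "lp_norm p m (trunc T x)
    = ennreal ((\<Sum>t\<le>T. \<Sum>j<m. \<bar>x t j\<bar> powr enn2real p) powr (1 / enn2real p))"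
proof -
  have "(\<Sum>t. \<Sum>j<m. ennreal (\<bar>trunc T x t j\<bar> powr enn2real p))
      = (\<Sum>t\<le>T. \<Sum>j<m. ennreal (\<bar>trunc T x t j\<bar> powr enn2real p))"
    by (rule suminf_finite) (auto simp: trunc_def)
  also have "\<dots> = ennreal (\<Sum>t\<le>T. \<Sum>j<m. \<bar>x t j\<bar> powr enn2real p)"
    by (simp add: trunc_def sum_nonneg)
  finally show ?thesis
    using assms by (simp add: lp_norm_def sum_nonneg)
qed

lemma lp_norm_1_trunc: "lp_norm 1 m (trunc T x) = ennreal (\<Sum>t\<le>T. \<Sum>j<m. \<bar>x t j\<bar>)"
  by (subst lp_norm_trunc_eq) (auto simp: sum_nonneg)

lemma lp_norm_2_trunc: "lp_norm 2 m (trunc T x) = ennreal (sqrt (\<Sum>t\<le>T. \<Sum>j<m. (x t j)\<^sup>2))"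
proof -
  have "\<bar>y\<bar> powr 2 = y\<^sup>2" for y :: real
    by (cases "y = 0") (auto simp: powr_numeral)
  then show ?thesis
    by (subst lp_norm_trunc_eq) (auto simp: sum_nonneg powr_half_sqrt)
qed

text \<open>Adjacency bounds the whole difference of two inputs, while the gain inequality involves
  truncations; entrywise domination connects them.\<close>

lemma lp_norm_trunc_le:
  assumes "1 \<le> p"
  shows "lp_norm p m (trunc T x) \<le> lp_norm p m x"
proof (cases "p = \<infinity>")
  case True
  have "ennreal \<bar>trunc T x t j\<bar> \<le> ennreal \<bar>x t j\<bar>" for t j by (simp add: trunc_def)
  then show ?thesis
    using True by (simp add: lp_norm_def) (intro SUP_mono' SUP_subset_mono order_refl, simp)
next
  case False
  define S where "S y = (\<Sum>t. \<Sum>j<m. ennreal (\<bar>y t j\<bar> powr enn2real p))" for y :: signal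
  have N: "lp_norm p m y = (if S y = \<infinity> then \<infinity> else ennreal (enn2real (S y) powr (1 / enn2real p)))" for y
    using False by (simp add: lp_norm_def S_def Let_def)
  have le: "S (trunc T x) \<le> S x"
    unfolding S_def by (intro suminf_le sum_mono) (auto simp: trunc_def)
  show ?thesis
  \<comment> \<open>\<open>enn2real\<close> sends infinity to 0 and is monotone only on finite
    values, so an infinite sum is treated apart.\<close>
  proof (cases "S x = \<infinity>")
    case True
    then show ?thesis by (simp add: N)
  next
    case False
    then have "enn2real (S (trunc T x)) powr (1 / enn2real p) \<le> enn2real (S x) powr (1 / enn2real p)"
      using le by (intro powr_mono2 enn2real_mono) (auto simp: top.not_eq_extremum)
    moreover have "S (trunc T x) \<noteq> \<infinity>" using le False by (auto simp: top_unique)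
    ultimately show ?thesis using False by (simp add: N ennreal_leI)
  qed
qed

section \<open>The algebra of cylinder sets\<close>

text \<open>The generator of \<open>cyl_algebra\<close>, named so that its closure properties can be
  stated.\<close>

definition cylinders :: "ennreal \<Rightarrow> nat \<Rightarrow> signal set set" where
  "cylinders s m = {{y \<in> lpe s m. (\<lambda>(t, j)\<in>{..T} \<times> {..<m}. y t j) \<in> H} | T H.
     H \<in> sets (Pi\<^sub>M ({..T} \<times> {..<m}) (\<lambda>_. borel))}"

text \<open>\<open>H\<close> is pulled back along the restriction map. This puts two cylinders on a
  common window before they are intersected.\<close>

lemma cylinder_extend:
  assumes "T \<le> T'" and H: "H \<in> sets (Pi\<^sub>M ({..T} \<times> {..<m}) (\<lambda>_. borel :: real measure))"
  shows "\<exists>H' \<in> sets (Pi\<^sub>M ({..T'} \<times> {..<m}) (\<lambda>_. borel)). \<forall>y :: signal.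
    (\<lambda>(t, j)\<in>{..T} \<times> {..<m}. y t j) \<in> H \<longleftrightarrow> (\<lambda>(t, j)\<in>{..T'} \<times> {..<m}. y t j) \<in> H'"
proof -
  let ?I = "{..T} \<times> {..<m}" and ?I' = "{..T'} \<times> {..<m}"
  have sub: "?I \<subseteq> ?I'" using assms(1) by auto
  have "(\<lambda>x. restrict x ?I) \<in> Pi\<^sub>M ?I' (\<lambda>_. borel :: real measure) \<rightarrow>\<^sub>M Pi\<^sub>M ?I (\<lambda>_. borel)"
    using sub by (rule measurable_restrict_subset)
  from measurable_sets[OF this H]
  have "(\<lambda>x. restrict x ?I) -` H \<inter> space (Pi\<^sub>M ?I' (\<lambda>_. borel)) \<in> sets (Pi\<^sub>M ?I' (\<lambda>_. borel))" .
  moreover have "restrict (\<lambda>(t, j)\<in>?I'. y t j) ?I = (\<lambda>(t, j)\<in>?I. y t j)" for y :: signal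
    using sub by (simp add: Int_absorb1)
  ultimately show ?thesis
    by (intro bexI) (auto simp: space_PiM)
qed

text \<open>A complement stays on the same window, and an intersection is formed on the longer of
  the two windows.\<close>

lemma algebra_cylinders: "algebra (lpe s m) (cylinders s m)"
  unfolding algebra_iff_Int
proof (intro conjI ballI)
  let ?P = "\<lambda>T. Pi\<^sub>M ({..T} \<times> {..<m}) (\<lambda>_. borel :: real measure)"
  let ?r = "\<lambda>T (y :: signal). \<lambda>(t, j)\<in>{..T} \<times> {..<m}. y t j"
  have I: "{y \<in> lpe s m. ?r T y \<in> H} \<in> cylinders s m" if "H \<in> sets (?P T)" for T H
    using that unfolding cylinders_def by blast
  show "cylinders s m \<subseteq> Pow (lpe s m)" by (auto simp: cylinders_def)
  show "{} \<in> cylinders s m" using I[of "{}" 0] by simp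
  fix a assume "a \<in> cylinders s m"
  then obtain T H where a: "a = {y \<in> lpe s m. ?r T y \<in> H}" and H: "H \<in> sets (?P T)"
    unfolding cylinders_def by blast
  have "lpe s m - a = {y \<in> lpe s m. ?r T y \<in> space (?P T) - H}"
    unfolding a by (auto simp: space_PiM)
  also have "\<dots> \<in> cylinders s m" using H by (intro I) auto
  finally show "lpe s m - a \<in> cylinders s m" .
  fix b assume "b \<in> cylinders s m"
  then obtain T' H' where b: "b = {y \<in> lpe s m. ?r T' y \<in> H'}" and H': "H' \<in> sets (?P T')"
    unfolding cylinders_def by blast
  obtain K where K: "K \<in> sets (?P (max T T'))" "\<And>y. ?r T y \<in> H \<longleftrightarrow> ?r (max T T') y \<in> K"
    using cylinder_extend[OF max.cobounded1 H] by blast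
  obtain K' where K': "K' \<in> sets (?P (max T T'))" "\<And>y. ?r T' y \<in> H' \<longleftrightarrow> ?r (max T T') y \<in> K'"
    using cylinder_extend[OF max.cobounded2 H'] by blast
  have "a \<inter> b = {y \<in> lpe s m. ?r (max T T') y \<in> K \<inter> K'}"
    unfolding a b using K(2) K'(2) by auto
  also have "\<dots> \<in> cylinders s m" using K K' by (intro I) auto
  finally show "a \<inter> b \<in> cylinders s m" .
qed

lemma
  shows space_cyl_algebra: "space (cyl_algebra s m) = lpe s m"
    and sets_cyl_algebra: "sets (cyl_algebra s m) = sigma_sets (lpe s m) (cylinders s m)"
proof -
  have "cylinders s m \<subseteq> Pow (lpe s m)" by (auto simp: cylinders_def)
  then show "space (cyl_algebra s m) = lpe s m"
    and "sets (cyl_algebra s m) = sigma_sets (lpe s m) (cylinders s m)"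
    unfolding cyl_algebra_def cylinders_def[symmetric]
    by (simp_all add: space_measure_of sets_measure_of)
qed

section \<open>Reduction to finite windows\<close>

text \<open>Measurability is checked on the generating cylinders. There the privacy inequality is
  the hypothesis \<open>fin\<close> on window laws, and \<open>measure_le_extend\<close> carries it
  to all measurable sets of signals.\<close>

lemma diff_private_noisyI:
  fixes F :: "'d \<Rightarrow> signal"
  assumes "prob_space \<Omega>" and "1 \<le> s" and wn: "white_noise \<Omega> m \<mu> w"
    and F: "\<And>u. u \<in> D \<Longrightarrow> F u \<in> signals m"
    and fin: "\<And>u u' T H. u \<in> D \<Longrightarrow> u' \<in> D \<Longrightarrow> Adj u u' \<Longrightarrow>
      H \<in> sets (Pi\<^sub>M ({..T} \<times> {..<m}) (\<lambda>_. borel)) \<Longrightarrow>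
      measure (distr \<Omega> (Pi\<^sub>M ({..T} \<times> {..<m}) (\<lambda>_. borel))
        (\<lambda>\<omega>. \<lambda>i\<in>{..T} \<times> {..<m}. F u (fst i) (snd i) + w \<omega> (fst i) (snd i))) H
      \<le> exp \<epsilon> * measure (distr \<Omega> (Pi\<^sub>M ({..T} \<times> {..<m}) (\<lambda>_. borel))
        (\<lambda>\<omega>. \<lambda>i\<in>{..T} \<times> {..<m}. F u' (fst i) (snd i) + w \<omega> (fst i) (snd i))) H + \<delta>"
  shows "diff_private \<Omega> (cyl_algebra s m) D Adj \<epsilon> \<delta> (noisy F w)"
proof -
  interpret prob_space \<Omega> by fact
  note [measurable] = white_noise_borel_measurable[OF assms(1) wn]
  let ?I = "\<lambda>T. {..T} \<times> {..<m}"
  let ?r = "\<lambda>T (y :: signal). \<lambda>(t, j)\<in>?I T. y t j"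
  let ?g = "\<lambda>T u \<omega>. \<lambda>i\<in>?I T. F u (fst i) (snd i) + w \<omega> (fst i) (snd i)"
  have g[measurable]: "?g T u \<in> \<Omega> \<rightarrow>\<^sub>M Pi\<^sub>M (?I T) (\<lambda>_. borel)" for T u
    by (intro measurable_restrict) measurable
  have r: "?r T (noisy F w u \<omega>) = ?g T u \<omega>" for T u \<omega>
    by (auto simp: noisy_def fun_eq_iff)
  have sp: "noisy F w u \<omega> \<in> lpe s m" if "u \<in> D" "\<omega> \<in> space \<Omega>" for u \<omega>
    using F[OF that(1)] wn that(2)
    by (auto simp: lpe_eq_signals[OF \<open>1 \<le> s\<close>] white_noise_def signals_def noisy_def)
  \<comment> \<open>An output lies in a cylinder exactly when its finite window lies in the base
    \<open>H\<close>.\<close>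
  have cyl: "noisy F w u -` {y \<in> lpe s m. ?r T y \<in> H} \<inter> space \<Omega> = ?g T u -` H \<inter> space \<Omega>"
    if "u \<in> D" for u T H
    using sp[OF that] by (auto simp: r)
  have meas: "noisy F w u \<in> \<Omega> \<rightarrow>\<^sub>M cyl_algebra s m" if u: "u \<in> D" for u
    unfolding cyl_algebra_def cylinders_def[symmetric]
  proof (rule measurable_measure_of)
    show "cylinders s m \<subseteq> Pow (lpe s m)" by (auto simp: cylinders_def)
    show "noisy F w u \<in> space \<Omega> \<rightarrow> lpe s m" using sp u by auto
    fix C assume "C \<in> cylinders s m"
    then obtain T H where C: "C = {y \<in> lpe s m. ?r T y \<in> H}" and H: "H \<in> sets (Pi\<^sub>M (?I T) (\<lambda>_. borel))"
      unfolding cylinders_def by blast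
    show "noisy F w u -` C \<inter> space \<Omega> \<in> events"
      unfolding C cyl[OF u] using H by (rule measurable_sets[OF g])
  qed
  have "measure \<Omega> {\<omega> \<in> space \<Omega>. noisy F w u \<omega> \<in> S}
      \<le> exp \<epsilon> * measure \<Omega> {\<omega> \<in> space \<Omega>. noisy F w u' \<omega> \<in> S} + \<delta>"
    if u: "u \<in> D" "u' \<in> D" "Adj u u'" and S: "S \<in> sets (cyl_algebra s m)" for u u' S
  proof -
    let ?M = "\<lambda>u. distr \<Omega> (cyl_algebra s m) (noisy F w u)"
    have eq: "measure (?M v) A = measure \<Omega> (noisy F w v -` A \<inter> space \<Omega>)"
      if "v \<in> D" "A \<in> sets (cyl_algebra s m)" for v A
      using that meas by (intro measure_distr) auto
    have "measure (?M u) S \<le> exp \<epsilon> * measure (?M u') S + \<delta>"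
    proof (rule measure_le_extend[OF algebra_cylinders])
      show "finite_measure (?M u)" "finite_measure (?M u')"
        using u meas by (auto intro!: finite_measure_distr)
      show "S \<in> sigma_sets (lpe s m) (cylinders s m)" using S by (simp add: sets_cyl_algebra)
      fix C assume "C \<in> cylinders s m"
      then obtain T H where C: "C = {y \<in> lpe s m. ?r T y \<in> H}" and H: "H \<in> sets (Pi\<^sub>M (?I T) (\<lambda>_. borel))"
        unfolding cylinders_def by blast
      have C': "C \<in> sets (cyl_algebra s m)"
        using \<open>C \<in> cylinders s m\<close> by (simp add: sets_cyl_algebra)
      have "measure (?M v) C = measure (distr \<Omega> (Pi\<^sub>M (?I T) (\<lambda>_. borel)) (?g T v)) H" if "v \<in> D" for v
        unfolding eq[OF that C'] measure_distr[OF g H] unfolding C cyl[OF that] ..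
      then show "measure (?M u) C \<le> exp \<epsilon> * measure (?M u') C + \<delta>"
        using fin[OF u H] u by simp
    qed (auto simp: sets_cyl_algebra)
    then show ?thesis
      using u S by (simp add: eq vimage_def Int_def conj_commute)
  qed
  with meas show ?thesis unfolding diff_private_def by blast
qed

section \<open>Sensitivity of the summed system\<close>

text \<open>Adjacent inputs differ in at most one channel, so all other summands cancel and a single
  gain applies. The maximum covers whichever channel it is.\<close>

lemma sum_system_sensitivity:
  assumes r: "\<And>i. i \<in> {1..n} \<Longrightarrow> 1 \<le> r i" and b: "\<And>i. i \<in> {1..n} \<Longrightarrow> 0 \<le> b i"
    and u: "u \<in> (\<Pi>\<^sub>E i\<in>{1..n}. lpe (r i) (m i))" "u' \<in> (\<Pi>\<^sub>E i\<in>{1..n}. lpe (r i) (m i))"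
    and adj: "adj n r m b u u'"
    and fin: "\<And>i. i \<in> {1..n} \<Longrightarrow> inc_gain (r i) (m i) q m' (G i) < \<infinity>"
  shows "lp_norm q m' (trunc T (sum_system n G u - sum_system n G u'))
    \<le> ennreal (Max ((\<lambda>i. enn2real (inc_gain (r i) (m i) q m' (G i)) * b i) ` {1..n}))"
proof -
  from adj obtain i where i: "i \<in> {1..n}" and le: "lp_norm (r i) (m i) (u i - u' i) \<le> ennreal (b i)"
    and eq: "\<And>j. j \<in> {1..n} \<Longrightarrow> j \<noteq> i \<Longrightarrow> u j = u' j"
    unfolding adj_def by blast
  let ?\<gamma> = "inc_gain (r i) (m i) q m' (G i)"
  have ui: "u i \<in> lpe (r i) (m i)" "u' i \<in> lpe (r i) (m i)" using u i by auto
  have "sum_system n G u t j - sum_system n G u' t j = G i (u i) t j - G i (u' i) t j" for t j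
  proof -
    have "sum_system n G u t j - sum_system n G u' t j = (\<Sum>k=1..n. G k (u k) t j - G k (u' k) t j)"
      by (simp add: sum_system_def sum_subtractf)
    also have "\<dots> = (\<Sum>k\<in>{i}. G k (u k) t j - G k (u' k) t j)"
      using i eq by (intro sum.mono_neutral_right) auto
    finally show ?thesis by simp
  qed
  then have "sum_system n G u - sum_system n G u' = G i (u i) - G i (u' i)"
    by (simp add: fun_eq_iff)
  then have "lp_norm q m' (trunc T (sum_system n G u - sum_system n G u'))
      = lp_norm q m' (trunc T (G i (u i)) - trunc T (G i (u' i)))"
    by (simp add: trunc_diff)
  also have "\<dots> \<le> ?\<gamma> * lp_norm (r i) (m i) (trunc T (u i) - trunc T (u' i))"
    using inc_gain_is_least(1)[OF r[OF i] fin[OF i]] ui by (auto simp: inc_gain_bound_def)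
  also have "\<dots> \<le> ?\<gamma> * ennreal (b i)"
    unfolding trunc_diff
    by (intro mult_left_mono order_trans[OF lp_norm_trunc_le[OF r[OF i]] le]) auto
  \<comment> \<open>Finiteness of the gain matters here: \<open>enn2real\<close> would turn an
    infinite gain into 0.\<close>
  also have "\<dots> = ennreal (enn2real ?\<gamma> * b i)"
    using fin[OF i] b[OF i] by (simp add: ennreal_mult)
  also have "\<dots> \<le> ennreal (Max ((\<lambda>i. enn2real (inc_gain (r i) (m i) q m' (G i)) * b i) ` {1..n}))"
    using i by (intro ennreal_leI Max_ge) auto
  finally show ?thesis .
qed

lemma signals_eqI:
  assumes "x \<in> signals m" "y \<in> signals m" and "\<And>t j. j < m \<Longrightarrow> x t j = y t j"
  shows "x = y"
proof (intro ext)
  show "x t j = y t j" for t j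
    using assms by (cases "j < m") (auto simp: signals_def)
qed

subsection \<open>Differential privacy of the noisy system\<close>

theorem theorem4:
  fixes \<epsilon> \<delta> :: real and n m' :: nat and r :: "nat \<Rightarrow> ennreal" and m :: "nat \<Rightarrow> nat"
    and s :: ennreal and b :: "nat \<Rightarrow> real" and G :: "nat \<Rightarrow> signal \<Rightarrow> signal"
    and \<Omega> :: "'a measure"
  assumes "0 < \<epsilon>" and "0 < \<delta>" and "\<delta> < 1"
    and "1 \<le> n"
    and "\<And>i. i \<in> {1..n} \<Longrightarrow> 1 \<le> r i"
    and "1 \<le> s"
    and "\<And>i. i \<in> {1..n} \<Longrightarrow> 0 \<le> b i"
    and "\<And>i. i \<in> {1..n} \<Longrightarrow> G i \<in> lpe (r i) (m i) \<rightarrow> lpe s m'"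
    and "\<And>i. i \<in> {1..n} \<Longrightarrow> causal_on (lpe (r i) (m i)) (G i)"
    and "prob_space \<Omega>"
  shows
    "((\<forall>i\<in>{1..n}. inc_gain (r i) (m i) 1 m' (G i) < \<infinity>) \<longrightarrow>
        (\<forall>B w. B \<ge> Max ((\<lambda>i. enn2real (inc_gain (r i) (m i) 1 m' (G i)) * b i) ` {1..n}) \<longrightarrow>
           white_noise \<Omega> m' (laplace (B / \<epsilon>)) w \<longrightarrow>
           diff_private \<Omega> (cyl_algebra s m') (\<Pi>\<^sub>E i\<in>{1..n}. lpe (r i) (m i)) (adj n r m b)
             \<epsilon> 0 (noisy (sum_system n G) w)))
     \<and>
     ((\<forall>i\<in>{1..n}. inc_gain (r i) (m i) 2 m' (G i) < \<infinity>) \<longrightarrow>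
        (\<forall>\<sigma> w. \<sigma> \<ge> \<kappa> \<delta> \<epsilon> * Max ((\<lambda>i. enn2real (inc_gain (r i) (m i) 2 m' (G i)) * b i) ` {1..n}) \<longrightarrow>
           white_noise \<Omega> m' (centered_normal \<sigma>) w \<longrightarrow>
           diff_private \<Omega> (cyl_algebra s m') (\<Pi>\<^sub>E i\<in>{1..n}. lpe (r i) (m i)) (adj n r m b)
             \<epsilon> \<delta> (noisy (sum_system n G) w)))"
proof (intro conjI impI allI)
  interpret prob_space \<Omega> by fact
  let ?U = "\<Pi>\<^sub>E i\<in>{1..n}. lpe (r i) (m i)"
  let ?F = "sum_system n G"
  let ?g = "\<lambda>T w u \<omega>. \<lambda>i\<in>{..T} \<times> {..<m'}. ?F u (fst i) (snd i) + w \<omega> (fst i) (snd i)"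
  have F: "?F u \<in> signals m'" if "u \<in> ?U" for u
  proof -
    have "G i (u i) \<in> signals m'" if "i \<in> {1..n}" for i
      using assms(8)[OF that] \<open>u \<in> ?U\<close> that by (auto simp: lpe_eq_signals[OF \<open>1 \<le> s\<close>])
    then show ?thesis by (simp add: signals_def sum_system_def)
  qed
  \<comment> \<open>With \<open>1 \<le> n\<close> the maximum ranges over a nonempty set.
    Nonnegativity of \<open>B\<close> and \<open>\<sigma>\<close> follows from this.\<close>
  have Max_nonneg: "0 \<le> Max ((\<lambda>i. enn2real (inc_gain (r i) (m i) q m' (G i)) * b i) ` {1..n})" for q
    using \<open>1 \<le> n\<close> assms(7)[of 1] by (intro Max_ge_iff[THEN iffD2]) (auto intro!: bexI[of _ 1])
  have trivial: "x \<le> exp \<epsilon> * x + d" if "0 \<le> x" "0 \<le> d" for x d :: real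
    using mult_right_mono[of 1 "exp \<epsilon>" x] that \<open>0 < \<epsilon>\<close> by simp
  {
    fix B w
    assume fin: "\<forall>i\<in>{1..n}. inc_gain (r i) (m i) 1 m' (G i) < \<infinity>"
      and B: "Max ((\<lambda>i. enn2real (inc_gain (r i) (m i) 1 m' (G i)) * b i) ` {1..n}) \<le> B"
      and wn: "white_noise \<Omega> m' (laplace (B / \<epsilon>)) w"
    have "0 \<le> B" using B Max_nonneg[of 1] by linarith
    show "diff_private \<Omega> (cyl_algebra s m') ?U (adj n r m b) \<epsilon> 0 (noisy ?F w)"
    proof (rule diff_private_noisyI[OF \<open>prob_space \<Omega>\<close> \<open>1 \<le> s\<close> wn F])
      fix u u' and T :: nat and H
      assume u: "u \<in> ?U" "u' \<in> ?U" "adj n r m b u u'"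
        and H: "H \<in> sets (Pi\<^sub>M ({..T} \<times> {..<m'}) (\<lambda>_. borel :: real measure))"
      \<comment> \<open>Stated for every window rather than the fixed one, since the degenerate case
        applies it to windows ending at arbitrary times.\<close>
      have sens: "(\<Sum>t\<le>T. \<Sum>j<m'. \<bar>?F u t j - ?F u' t j\<bar>) \<le> B" for T
        using order_trans[OF sum_system_sensitivity[OF assms(5,7) u, of 1 m' G T] ennreal_leI[OF B]] fin \<open>0 \<le> B\<close>
        by (simp add: lp_norm_1_trunc)
      show "measure (distr \<Omega> (Pi\<^sub>M ({..T} \<times> {..<m'}) (\<lambda>_. borel)) (?g T w u)) H
        \<le> exp \<epsilon> * measure (distr \<Omega> (Pi\<^sub>M ({..T} \<times> {..<m'}) (\<lambda>_. borel)) (?g T w u')) H + 0"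
      \<comment> \<open>At scale 0 the noise has no density, but zero sensitivity forces the
        noiseless outputs to coincide, so both window laws are the same.\<close>
      proof (cases "B = 0")
        case True
        have "?F u = ?F u'"
        proof (rule signals_eqI[OF F F])
          fix t j assume "j < m'"
          then have "\<bar>?F u t j - ?F u' t j\<bar> \<le> (\<Sum>j<m'. \<bar>?F u t j - ?F u' t j\<bar>)"
            by (intro member_le_sum) auto
          also have "\<dots> \<le> (\<Sum>t\<le>t. \<Sum>j<m'. \<bar>?F u t j - ?F u' t j\<bar>)"
            by (rule member_le_sum) (auto intro: sum_nonneg)
          finally show "?F u t j = ?F u' t j" using sens[of t] True by linarith
        qed (use u in auto)
        then show ?thesis by (simp only:) (rule trivial; simp)
      next
        case False
        define f where "f = (\<lambda>x. ennreal (1 / (2 * (B / \<epsilon>)) * exp (- \<bar>x\<bar> / (B / \<epsilon>))))"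
        have f: "f \<in> borel_measurable borel" "\<And>x. f x \<noteq> \<infinity>" unfolding f_def by auto
        have "laplace (B / \<epsilon>) = density lborel f"
          using False \<open>0 < \<epsilon>\<close> by (simp add: laplace_def f_def)
        then have wn': "white_noise \<Omega> m' (density lborel f) w" using wn by simp
        have law: "distr \<Omega> (Pi\<^sub>M ({..T} \<times> {..<m'}) (\<lambda>_. borel)) (?g T w v)
            = Pi\<^sub>M ({..T} \<times> {..<m'}) (\<lambda>i. density lborel (\<lambda>x. f (x - ?F v (fst i) (snd i))))" for v
          using white_noise_shifted_law[OF \<open>prob_space \<Omega>\<close> wn' f, of T "\<lambda>i. ?F v (fst i) (snd i)"] .
        note [measurable] = white_noise_borel_measurable[OF \<open>prob_space \<Omega>\<close> wn]
        have "prob_space (distr \<Omega> (Pi\<^sub>M ({..T} \<times> {..<m'}) (\<lambda>_. borel)) (?g T w v))" for v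
          by (intro prob_space_distr measurable_restrict) measurable
        note pr = this[THEN prob_space.finite_measure, THEN finite_measure.emeasure_eq_measure]
        have "emeasure (distr \<Omega> (Pi\<^sub>M ({..T} \<times> {..<m'}) (\<lambda>_. borel)) (?g T w u)) H
            \<le> ennreal (exp \<epsilon>) * emeasure (distr \<Omega> (Pi\<^sub>M ({..T} \<times> {..<m'}) (\<lambda>_. borel)) (?g T w u')) H"
          unfolding law f_def
        proof (rule laplace_product_le[OF _ _ _ H])
          show "0 < B / \<epsilon>" using False \<open>0 \<le> B\<close> \<open>0 < \<epsilon>\<close> by simp
          show "(\<Sum>i\<in>{..T} \<times> {..<m'}. \<bar>?F u (fst i) (snd i) - ?F u' (fst i) (snd i)\<bar>) \<le> \<epsilon> * (B / \<epsilon>)"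
            using sens[of T] \<open>0 < \<epsilon>\<close> by (simp add: sum.cartesian_product split_beta)
        qed simp
        then show ?thesis
          unfolding pr by (simp add: ennreal_mult[symmetric])
      qed
    qed
  next
    fix \<sigma> w
    assume fin: "\<forall>i\<in>{1..n}. inc_gain (r i) (m i) 2 m' (G i) < \<infinity>"
      and \<sigma>: "\<kappa> \<delta> \<epsilon> * Max ((\<lambda>i. enn2real (inc_gain (r i) (m i) 2 m' (G i)) * b i) ` {1..n}) \<le> \<sigma>"
      and wn: "white_noise \<Omega> m' (centered_normal \<sigma>) w"
    define k where "k = \<kappa> \<delta> \<epsilon>"
    have "0 < k" using kappa_pos[OF \<open>0 < \<epsilon>\<close>] by (simp add: k_def)
    have "0 \<le> \<sigma>" using order_trans[OF mult_nonneg_nonneg[OF _ Max_nonneg[of 2]] \<sigma>] \<open>0 < k\<close> by (simp add: k_def)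
    show "diff_private \<Omega> (cyl_algebra s m') ?U (adj n r m b) \<epsilon> \<delta> (noisy ?F w)"
    proof (rule diff_private_noisyI[OF \<open>prob_space \<Omega>\<close> \<open>1 \<le> s\<close> wn F])
      fix u u' and T :: nat and H
      assume u: "u \<in> ?U" "u' \<in> ?U" "adj n r m b u u'"
        and H: "H \<in> sets (Pi\<^sub>M ({..T} \<times> {..<m'}) (\<lambda>_. borel :: real measure))"
      have sens: "k * sqrt (\<Sum>t\<le>T. \<Sum>j<m'. (?F u t j - ?F u' t j)\<^sup>2) \<le> \<sigma>" for T
      proof -
        have "sqrt (\<Sum>t\<le>T. \<Sum>j<m'. (?F u t j - ?F u' t j)\<^sup>2)
            \<le> Max ((\<lambda>i. enn2real (inc_gain (r i) (m i) 2 m' (G i)) * b i) ` {1..n})"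
          using sum_system_sensitivity[OF assms(5,7) u, of 2 m' G T] fin Max_nonneg[of 2]
          by (simp add: lp_norm_2_trunc)
        from mult_left_mono[OF this less_imp_le[OF \<open>0 < k\<close>]] \<sigma> show ?thesis
          unfolding k_def by linarith
      qed
      show "measure (distr \<Omega> (Pi\<^sub>M ({..T} \<times> {..<m'}) (\<lambda>_. borel)) (?g T w u)) H
        \<le> exp \<epsilon> * measure (distr \<Omega> (Pi\<^sub>M ({..T} \<times> {..<m'}) (\<lambda>_. borel)) (?g T w u')) H + \<delta>"
      \<comment> \<open>As for Laplace noise: \<open>0 < k\<close> turns the bound
        \<open>sens\<close> with \<open>\<sigma> = 0\<close> into equality of the noiseless
        outputs.\<close>
      proof (cases "\<sigma> = 0")
        case True
        have "?F u = ?F u'"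
        proof (rule signals_eqI[OF F F])
          fix t j assume "j < m'"
          then have "(?F u t j - ?F u' t j)\<^sup>2 \<le> (\<Sum>j<m'. (?F u t j - ?F u' t j)\<^sup>2)"
            by (intro member_le_sum) auto
          also have "\<dots> \<le> (\<Sum>t\<le>t. \<Sum>j<m'. (?F u t j - ?F u' t j)\<^sup>2)"
            by (rule member_le_sum) (auto intro: sum_nonneg)
          also have "\<dots> \<le> 0"
            using sens[of t] True \<open>0 < k\<close> by (simp add: mult_le_0_iff)
          finally show "?F u t j = ?F u' t j" by simp
        qed (use u in auto)
        then show ?thesis using \<open>0 < \<delta>\<close> by (simp only:) (rule trivial; simp)
      next
        case False
        have "centered_normal \<sigma> = density lborel (normal_density 0 \<sigma>)"
          using False by (simp add: centered_normal_def)
        then have wn': "white_noise \<Omega> m' (density lborel (normal_density 0 \<sigma>)) w" using wn by simp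
        have law: "distr \<Omega> (Pi\<^sub>M ({..T} \<times> {..<m'}) (\<lambda>_. borel)) (?g T w v)
            = Pi\<^sub>M ({..T} \<times> {..<m'}) (\<lambda>i. density lborel (normal_density (?F v (fst i) (snd i)) \<sigma>))" for v
          \<comment> \<open>Shifting the argument of a centred normal density is the same as moving
            its mean.\<close>
          using white_noise_shifted_law[OF \<open>prob_space \<Omega>\<close> wn', of T "\<lambda>i. ?F v (fst i) (snd i)"]
          by (simp add: normal_density_def)
        show ?thesis
          unfolding law
        proof (rule gaussian_product_le[OF _ _ \<open>0 < \<epsilon>\<close> \<open>0 < \<delta>\<close> \<open>\<delta> < 1\<close> _ H])
          show "0 < \<sigma>" using False \<open>0 \<le> \<sigma>\<close> by simp
          show "\<kappa> \<delta> \<epsilon> * sqrt (\<Sum>i\<in>{..T} \<times> {..<m'}. (?F u (fst i) (snd i) - ?F u' (fst i) (snd i))\<^sup>2) \<le> \<sigma>"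
            using sens[of T] by (simp add: sum.cartesian_product split_beta k_def)
        qed simp
      qed
    qed
  }
qed

end
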